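(* Let $(N_t)_{t\ge 1}$ be the counting process of the discrete-time marked Hawkes process with parameters $\nu$, $\alpha$ and marks $\ell_{t,j}$ described in the context, where $\Vert\alpha\Vert_1\mathbb{E}[\ell_{1,1}]<1$. Then $\mathbb{P}(N_t/t\in\cdot)$ satisfies a large deviation principle on $\mathbb{R}$ with speed $t$ (as $t\to\infty$) and with the rate function $$I(x)=\sup_{\theta\le\theta_c}\{\theta x-\Gamma(\theta)\},\qquad x\in\mathbb{R},$$ where $\Gamma(\theta):=\nu(g(\theta)-1)$ and, for any $\theta\le\theta_c$, $g(\theta)$ is the minimal solution $x$ to the equation $$x=\mathbb{E}\left[e^{\theta+\Vert\alpha\Vert_1\ell_{1,1}(x-1)}\right],$$ where $$\theta_c=-\log\mathbb{E}\left[\Vert\alpha\Vert_1\ell_{1,1}e^{\Vert\alpha\Vert_1\ell_{1,1}(x_c-1)}\right]>0,$$ and where $x_c>1$ satisfies the equation $$x_c\,\mathbb{E}\left[\Vert\alpha\Vert_1\ell_{1,1}e^{\Vert\alpha\Vert_1\ell_{1,1}(x_c-1)}\right]=\mathbb{E}\left[e^{\Vert\alpha\Vert_1\ell_{1,1}(x_c-1)}\right].$$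
   Context: Discrete-time marked Hawkes process. Let $\mathbb{N}=\{1,2,\ldots\}$, let $\nu>0$ be a constant, let $\alpha:\mathbb{N}\to\mathbb{R}_+$ be a positive function, and let $\Vert\alpha\Vert_1:=\sum_{t=1}^\infty\alpha(t)$. Let $\ell_{t,j}$ ($t,j\in\mathbb{N}$) be positive random variables that are i.i.d. in both $t$ and $j$ (the marks). Set $X_0=N_0=0$. For each $t\ge 1$, conditional on the past $\mathcal{F}_{t-1}$ (the natural filtration up to time $t-1$, generated by $Z_s,X_s$ for $1\le s\le t-1$), $Z_t$ is a Poisson random variable with mean $$\lambda_t=\nu+\sum_{s=1}^{t-1}\alpha(s)X_{t-s},$$ and $X_t=\sum_{j=1}^{Z_t}\ell_{t,j}$, so that conditional on $\mathcal{F}_{t-1}$, $X_t$ is a compound Poisson random variable with intensity $\lambda_t$ and jump distribution that of $\ell_{1,1}$ (the marks $\ell_{t,j}$, $j\ge1$, being independent of $Z_t$ and of $\mathcal{F}_{t-1}$). Define $N_t:=\sum_{s=1}^tZ_s$ and $L_t:=\sum_{s=1}^tX_s$. Standing assumption: $\Vert\alpha\Vert_1\mathbb{E}[\ell_{1,1}]<1$. Large deviation principle. A family of probability measures $\{\mathbb{P}_n\}_{n\in\mathbb{N}}$ on a topological space $X$ satisfies the large deviation principle with rate function $I:X\to[0,\infty]$ and speed $a_n$ (positive and increasing to infinity) if $I$ is lower semi-continuous and for every Borel set $A$, $$-\inf_{x\in A^{o}}I(x)\le\liminf_{n\to\infty}\frac{1}{a_n}\log\mathbb{P}_n(A)\le\limsup_{n\to\infty}\frac{1}{a_n}\log\mathbb{P}_n(A)\le-\inf_{x\in\overline{A}}I(x),$$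 where $A^{o}$ and $\overline{A}$ are the interior and closure of $A$. *)

theory Defs
  imports "HOL-Probability.Probability"
begin

section \<open>Large deviation principle\<close>

definition log_prob :: "real \<Rightarrow> ereal" where
  "log_prob p = (if p = 0 then -\<infinity> else ereal (ln p))"

definition lower_semicontinuous :: "('a::topological_space \<Rightarrow> ereal) \<Rightarrow> bool" where
  "lower_semicontinuous I \<longleftrightarrow> (\<forall>c. open {x. c < I x})"

text \<open>The family is indexed by the positive integers; the values of \<open>P\<close> and \<open>a\<close> at \<open>0\<close> are
  irrelevant. Infima over the empty set are \<open>\<infinity>\<close>.\<close>

definition satisfies_LDP ::
    "(nat \<Rightarrow> 'a::topological_space measure) \<Rightarrow> (nat \<Rightarrow> real) \<Rightarrow> ('a \<Rightarrow> ereal) \<Rightarrow> bool" where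
  "satisfies_LDP P a I \<longleftrightarrow>
     (\<forall>n\<ge>1. prob_space (P n) \<and> sets (P n) = sets borel) \<and>
     (\<forall>n\<ge>1. 0 < a n) \<and> mono_on {1..} a \<and> filterlim a at_top sequentially \<and>
     (\<forall>x. 0 \<le> I x) \<and> lower_semicontinuous I \<and>
     (\<forall>A\<in>sets borel.
        - (INF x\<in>interior A. I x) \<le> liminf (\<lambda>n. ereal (1 / a n) * log_prob (measure (P n) A)) \<and>
        limsup (\<lambda>n. ereal (1 / a n) * log_prob (measure (P n) A)) \<le> - (INF x\<in>closure A. I x))"

section \<open>The discrete-time marked Hawkes process\<close>

text \<open>The \<open>\<sigma>\<close>-algebra generated by \<open>Z s\<close> and \<open>X s\<close> for \<open>1 \<le> s \<le> t\<close>.\<close>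

definition history ::
    "'a measure \<Rightarrow> (nat \<Rightarrow> 'a \<Rightarrow> nat) \<Rightarrow> (nat \<Rightarrow> 'a \<Rightarrow> real) \<Rightarrow> nat \<Rightarrow> 'a measure" where
  "history M Z X t = sigma (space M)
     (\<Union>s\<in>{1..t}. {Z s -` A \<inter> space M |A. A \<in> sets (count_space UNIV)} \<union>
                  {X s -` B \<inter> space M |B. B \<in> sets borel})"

text \<open>The \<open>\<sigma>\<close>-algebra generated by \<open>history M Z X (t - 1)\<close> and \<open>Z t\<close>.\<close>

definition history_with_count ::
    "'a measure \<Rightarrow> (nat \<Rightarrow> 'a \<Rightarrow> nat) \<Rightarrow> (nat \<Rightarrow> 'a \<Rightarrow> real) \<Rightarrow> nat \<Rightarrow> 'a measure" where
  "history_with_count M Z X t = sigma (space M)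
     (sets (history M Z X (t - 1)) \<union>
      {Z t -` A \<inter> space M |A. A \<in> sets (count_space UNIV)})"

text \<open>The \<open>\<sigma>\<close>-algebra generated by the marks \<open>l t j\<close>, \<open>j \<ge> 1\<close>, of time \<open>t\<close>.\<close>

definition marks_algebra ::
    "'a measure \<Rightarrow> (nat \<Rightarrow> nat \<Rightarrow> 'a \<Rightarrow> real) \<Rightarrow> nat \<Rightarrow> 'a measure" where
  "marks_algebra M l t = sigma (space M)
     (\<Union>j\<in>{1..}. {l t j -` B \<inter> space M |B. B \<in> sets borel})"

definition intensity ::
    "real \<Rightarrow> (nat \<Rightarrow> real) \<Rightarrow> (nat \<Rightarrow> 'a \<Rightarrow> real) \<Rightarrow> nat \<Rightarrow> 'a \<Rightarrow> real" where
  "intensity \<nu> \<alpha> X t \<omega> = \<nu> + (\<Sum>s=1..t-1. \<alpha> s * X (t - s) \<omega>)"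

text \<open>Times and mark indices start at \<open>1\<close>. The conditional law of \<open>Z t\<close> given the past is
  expressed through the conditional expectations of the indicators of \<open>Z t = k\<close>. That \<open>X t\<close> is
  conditionally compound Poisson follows, the marks of time \<open>t\<close> being i.i.d. and independent of
  \<open>Z t\<close> and the past jointly.\<close>

locale discrete_marked_hawkes = prob_space M
  for M :: "'a measure" +
  fixes \<nu> :: real
    and \<alpha> :: "nat \<Rightarrow> real"
    and l :: "nat \<Rightarrow> nat \<Rightarrow> 'a \<Rightarrow> real"
    and Z :: "nat \<Rightarrow> 'a \<Rightarrow> nat"
    and X :: "nat \<Rightarrow> 'a \<Rightarrow> real"
  assumes nu_pos: "0 < \<nu>"
    and alpha_pos: "\<And>t. 1 \<le> t \<Longrightarrow> 0 < \<alpha> t"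
    and marks_indep: "indep_vars (\<lambda>_. borel) (\<lambda>(t, j). l t j) ({1..} \<times> {1..})"
    and marks_distr: "\<And>t j. 1 \<le> t \<Longrightarrow> 1 \<le> j \<Longrightarrow> distr M borel (l t j) = distr M borel (l 1 1)"
    and marks_pos: "\<And>t j. 1 \<le> t \<Longrightarrow> 1 \<le> j \<Longrightarrow> AE \<omega> in M. 0 < l t j \<omega>"
    and Z_measurable: "\<And>t. 1 \<le> t \<Longrightarrow> Z t \<in> measurable M (count_space UNIV)"
    and X_0: "\<And>\<omega>. \<omega> \<in> space M \<Longrightarrow> X 0 \<omega> = 0"
    and X_eq: "\<And>t \<omega>. 1 \<le> t \<Longrightarrow> \<omega> \<in> space M \<Longrightarrow> X t \<omega> = (\<Sum>j=1..Z t \<omega>. l t j \<omega>)"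
    and Z_cond_Poisson: "\<And>t k. 1 \<le> t \<Longrightarrow>
          AE \<omega> in M. real_cond_exp M (history M Z X (t - 1)) (indicator {\<omega> \<in> space M. Z t \<omega> = k}) \<omega>
                   = pmf (poisson_pmf (intensity \<nu> \<alpha> X t \<omega>)) k"
    and marks_indep_past: "\<And>t. 1 \<le> t \<Longrightarrow>
          indep_set (sets (marks_algebra M l t)) (sets (history_with_count M Z X t))"

definition counting_process :: "(nat \<Rightarrow> 'a \<Rightarrow> nat) \<Rightarrow> nat \<Rightarrow> 'a \<Rightarrow> nat" where
  "counting_process Z t \<omega> = (\<Sum>s=1..t. Z s \<omega>)"

section \<open>The rate function\<close>

text \<open>The sum starts at \<open>\<alpha> 1\<close>.\<close>

definition norm1 :: "(nat \<Rightarrow> real) \<Rightarrow> real" where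
  "norm1 \<alpha> = (\<Sum>t. \<alpha> (Suc t))"

text \<open>Below, \<open>a\<close> is \<open>norm1 \<alpha>\<close> and \<open>m\<close> is the mark \<open>l 1 1\<close>. All equations between expectations are
  between finite quantities; integrability is required explicitly because the Bochner integral of
  a non-integrable function is \<open>0\<close>.\<close>

definition g_equation :: "'a measure \<Rightarrow> real \<Rightarrow> ('a \<Rightarrow> real) \<Rightarrow> real \<Rightarrow> real \<Rightarrow> bool" where
  "g_equation M a m \<theta> x \<longleftrightarrow>
     integrable M (\<lambda>\<omega>. exp (\<theta> + a * m \<omega> * (x - 1))) \<and>
     x = (\<integral>\<omega>. exp (\<theta> + a * m \<omega> * (x - 1)) \<partial>M)"

definition minimal_solution :: "('b::order \<Rightarrow> bool) \<Rightarrow> 'b \<Rightarrow> bool" where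
  "minimal_solution S x \<longleftrightarrow> S x \<and> (\<forall>y. S y \<longrightarrow> x \<le> y)"

definition g :: "'a measure \<Rightarrow> real \<Rightarrow> ('a \<Rightarrow> real) \<Rightarrow> real \<Rightarrow> real" where
  "g M a m \<theta> = (THE x. minimal_solution (g_equation M a m \<theta>) x)"

definition \<Gamma> :: "'a measure \<Rightarrow> real \<Rightarrow> real \<Rightarrow> ('a \<Rightarrow> real) \<Rightarrow> real \<Rightarrow> real" where
  "\<Gamma> M \<nu> a m \<theta> = \<nu> * (g M a m \<theta> - 1)"

definition critical_equation :: "'a measure \<Rightarrow> real \<Rightarrow> ('a \<Rightarrow> real) \<Rightarrow> real \<Rightarrow> bool" where
  "critical_equation M a m x \<longleftrightarrow>
     integrable M (\<lambda>\<omega>. a * m \<omega> * exp (a * m \<omega> * (x - 1))) \<and>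
     integrable M (\<lambda>\<omega>. exp (a * m \<omega> * (x - 1))) \<and>
     x * (\<integral>\<omega>. a * m \<omega> * exp (a * m \<omega> * (x - 1)) \<partial>M) = (\<integral>\<omega>. exp (a * m \<omega> * (x - 1)) \<partial>M)"

definition \<theta>\<^sub>c :: "'a measure \<Rightarrow> real \<Rightarrow> ('a \<Rightarrow> real) \<Rightarrow> real \<Rightarrow> real" where
  "\<theta>\<^sub>c M a m x\<^sub>c = - ln (\<integral>\<omega>. a * m \<omega> * exp (a * m \<omega> * (x\<^sub>c - 1)) \<partial>M)"

definition rate_function ::
    "'a measure \<Rightarrow> real \<Rightarrow> real \<Rightarrow> ('a \<Rightarrow> real) \<Rightarrow> real \<Rightarrow> real \<Rightarrow> ereal" where
  "rate_function M \<nu> a m x\<^sub>c x = (SUP \<theta>\<in>{..\<theta>\<^sub>c M a m x\<^sub>c}. ereal (\<theta> * x - \<Gamma> M \<nu> a m \<theta>))"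

end

theory Submission
  imports Defs
begin

text \<open>Conditioning backwards in time turns the moment generating function of \<open>N\<^sub>t\<close> into
  \<open>exp (\<nu> (\<Sum>k<t. G k - 1))\<close>, where \<open>G n = exp \<theta> * E[exp (l (\<Sum>s=1..n. \<alpha> s (G (n - s) - 1)))]\<close>. For
  \<open>\<theta> \<le> \<theta>\<^sub>c\<close> the sequence \<open>G\<close> is monotone, lies between \<open>1\<close> and \<open>g \<theta>\<close>, and its limit solves the equation
  of \<open>g \<theta>\<close>; hence the logarithm of the moment generating function, divided by \<open>t\<close>, tends to
  \<open>\<Gamma> \<theta>\<close>. The upper bound is then Chernoff's inequality for finitely many half-lines, the lower bound
  is exponential tilting. No information on \<open>\<theta> > \<theta>\<^sub>c\<close> is needed, because \<open>\<Gamma>\<close> is steep at \<open>\<theta>\<^sub>c\<close>: with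
  \<open>\<phi> y = E[exp (\<parallel>\<alpha>\<parallel> l (y - 1))]\<close>, the map \<open>h y = ln y - ln (\<phi> y)\<close> is the inverse of \<open>g\<close>, increases on
  \<open>(0, x\<^sub>c]\<close> and has derivative \<open>0\<close> at \<open>x\<^sub>c\<close>, so for \<open>x > 0\<close> the supremum of
  \<open>h y * x - \<nu> (y - 1)\<close> is attained at an interior point.\<close>

section \<open>Large deviations from the limiting cumulant generating function\<close>

lemma log_prob_le_iff: "0 \<le> p \<Longrightarrow> log_prob p \<le> ereal c \<longleftrightarrow> p \<le> exp c"
  by (auto simp: log_prob_def ln_le_cancel_iff[of p "exp c", symmetric] simp del: ln_le_cancel_iff)

lemma log_prob_ge_iff: "0 \<le> p \<Longrightarrow> ereal c \<le> log_prob p \<longleftrightarrow> exp c \<le> p"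
  by (auto simp: log_prob_def ln_le_cancel_iff[of "exp c" p, symmetric] not_le simp del: ln_le_cancel_iff)

lemma ereal_scale_le_iff:
  assumes "0 < (r::real)"
  shows "ereal (1 / r) * y \<le> ereal c \<longleftrightarrow> y \<le> ereal (r * c)"
    and "ereal c \<le> ereal (1 / r) * y \<longleftrightarrow> ereal (r * c) \<le> y"
  using assms by (cases y; simp add: field_simps)+

text \<open>\<open>T\<close> collects the arguments at which the limit is known. The Hawkes process
  will supply the half-line up to and including \<open>\<theta>\<^sub>c\<close>, so the supremum in
  \<open>rate\<close> runs over \<open>T\<close> only.\<close>

locale scaled_log_mgf = prob_space M for M :: "'a measure" +
  fixes S :: "nat \<Rightarrow> 'a \<Rightarrow> real" and T :: "real set" and \<Lambda> :: "real \<Rightarrow> real"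
  assumes S_measurable [measurable]: "\<And>n. S n \<in> borel_measurable M"
    and integrable_exp: "\<And>\<theta> n. \<theta> \<in> T \<Longrightarrow> integrable M (\<lambda>\<omega>. exp (\<theta> * S n \<omega>))"
    and log_mgf_tendsto: "\<And>\<theta>. \<theta> \<in> T \<Longrightarrow>
      (\<lambda>n. ln (expectation (\<lambda>\<omega>. exp (\<theta> * S n \<omega>))) / real n) \<longlonglongrightarrow> \<Lambda> \<theta>"
begin

abbreviation mgf :: "nat \<Rightarrow> real \<Rightarrow> real" where
  "mgf n \<theta> \<equiv> expectation (\<lambda>\<omega>. exp (\<theta> * S n \<omega>))"

abbreviation law :: "nat \<Rightarrow> real measure" where
  "law n \<equiv> distr M borel (\<lambda>\<omega>. S n \<omega> / real n)"

definition rate :: "real \<Rightarrow> ereal" where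
  "rate x = (SUP \<theta>\<in>T. ereal (\<theta> * x - \<Lambda> \<theta>))"

lemma mgf_pos: "\<theta> \<in> T \<Longrightarrow> 0 < mgf n \<theta>"
  by (intro expectation_greater integrable_exp) auto

lemma measure_law:
  "A \<in> sets borel \<Longrightarrow> measure (law n) A = prob {\<omega> \<in> space M. S n \<omega> / real n \<in> A}"
  by (subst measure_distr) (auto simp: vimage_def Int_def intro!: arg_cong[where f=prob])

section \<open>Upper bound: Chernoff estimates and finite covers\<close>

text \<open>Markov's inequality for \<open>exp (\<theta> * S n)\<close> at the level
  \<open>exp (n * (\<Lambda> \<theta> + c))\<close>. The gap between \<open>c'\<close> and
  \<open>c\<close> absorbs the distance of \<open>ln (mgf n \<theta>) / n\<close> from its
  limit.\<close>

lemma eventually_chernoff: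
  assumes "\<theta> \<in> T" "c' < c"
  shows "eventually (\<lambda>n. measure (law n) {x. c < \<theta> * x - \<Lambda> \<theta>} \<le> exp (- (real n * c'))) sequentially"
proof -
  have "eventually (\<lambda>n. ln (mgf n \<theta>) / real n < \<Lambda> \<theta> + (c - c')) sequentially"
    using log_mgf_tendsto[OF assms(1)] assms(2) by (intro order_tendstoD) auto
  with eventually_gt_at_top[of 0] show ?thesis
  proof eventually_elim
    fix n :: nat assume n: "0 < n" and "ln (mgf n \<theta>) / real n < \<Lambda> \<theta> + (c - c')"
    then have "ln (mgf n \<theta>) \<le> real n * (\<Lambda> \<theta> + (c - c'))" by (simp add: field_simps)
    then have E: "mgf n \<theta> \<le> exp (real n * (\<Lambda> \<theta> + (c - c')))"
      using mgf_pos[OF assms(1)] by (metis exp_le_cancel_iff exp_ln)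
    have "{x. c < \<theta> * x - \<Lambda> \<theta>} \<in> sets borel" by measurable
    then have "measure (law n) {x. c < \<theta> * x - \<Lambda> \<theta>}
        = prob {\<omega> \<in> space M. c < \<theta> * (S n \<omega> / real n) - \<Lambda> \<theta>}"
      by (simp add: measure_law)
    also have "\<dots> \<le> prob {\<omega> \<in> space M. exp (real n * (\<Lambda> \<theta> + c)) \<le> exp (\<theta> * S n \<omega>)}"
      using n by (intro finite_measure_mono) (auto simp: field_simps)
    also have "\<dots> \<le> mgf n \<theta> / exp (real n * (\<Lambda> \<theta> + c))"
      using integral_Markov_inequality_measure[OF integrable_exp[OF assms(1), of n], of "{}"
          "exp (real n * (\<Lambda> \<theta> + c))"] by simp
    also have "\<dots> \<le> exp (real n * (\<Lambda> \<theta> + (c - c'))) / exp (real n * (\<Lambda> \<theta> + c))"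
      using E by (intro divide_right_mono) auto
    also have "\<dots> = exp (- (real n * c'))"
      by (simp add: exp_diff[symmetric] algebra_simps)
    finally show "measure (law n) {x. c < \<theta> * x - \<Lambda> \<theta>} \<le> exp (- (real n * c'))" .
  qed
qed

text \<open>For \<open>c\<close> below the infimum of \<open>rate\<close>, the open sets
  \<open>c < \<theta> * x - \<Lambda> \<theta>\<close> cover \<open>closure A\<close>. One positive
  and one negative tilt catch all points far from the origin, compactness leaves finitely many
  further tilts, and a union bound over Chernoff estimates concludes.\<close>

lemma limsup_closure_le:
  assumes A: "A \<in> sets borel"
    and tight: "\<theta>p \<in> T" "0 < \<theta>p" "\<theta>m \<in> T" "\<theta>m < 0"
  shows "limsup (\<lambda>n. ereal (1 / real n) * log_prob (measure (law n) A))
           \<le> - (INF x\<in>closure A. rate x)"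
proof (rule ccontr)
  let ?L = "limsup (\<lambda>n. ereal (1 / real n) * log_prob (measure (law n) A))"
  assume "\<not> ?thesis"
  then have "- (INF x\<in>closure A. rate x) < ?L" by (simp only: not_le)
  \<comment> \<open>The levels are ordered \<open>- INF < b < c' < d < limsup\<close>. The gap from
    \<open>b\<close> to \<open>c'\<close> is spent on Chernoff's inequality, the gap from
    \<open>c'\<close> to \<open>d\<close> on the number of sets in the union bound.\<close>
  from ereal_dense2[OF this] obtain d
    where d: "- (INF x\<in>closure A. rate x) < ereal d" "ereal d < ?L" by blast
  from ereal_dense2[OF d(1)] obtain b
    where b: "- (INF x\<in>closure A. rate x) < ereal b" "b < d" by auto
  obtain c' where c': "b < c'" "c' < d" using dense b(2) by blast
  define c where "c = - b"
  define U where "U = (\<lambda>\<theta>. {x. c < \<theta> * x - \<Lambda> \<theta>})"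
  have U_open: "open (U \<theta>)" for \<theta>
    unfolding U_def by (intro open_Collect_less continuous_intros)
  have cover: "\<exists>\<theta>\<in>T. x \<in> U \<theta>" if "x \<in> closure A" for x
  proof -
    have "ereal c < (INF x\<in>closure A. rate x)"
      using b(1) ereal_minus_less_minus[of "INF x\<in>closure A. rate x" "ereal c"] by (simp add: c_def)
    also have "\<dots> \<le> rate x" using that by (intro INF_lower)
    finally show ?thesis unfolding rate_def U_def less_SUP_iff by simp
  qed
  \<comment> \<open>From \<open>K\<close> on, the line of slope \<open>\<theta>p\<close> is above
    the level \<open>c\<close>; up to \<open>- K\<close>, the line of slope \<open>\<theta>m\<close>
    is.\<close>
  define K where "K = max ((\<bar>c + \<Lambda> \<theta>p\<bar> + 1) / \<theta>p) ((\<bar>c + \<Lambda> \<theta>m\<bar> + 1) / - \<theta>m)"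
  have Kp: "x \<in> U \<theta>p" if "K \<le> x" for x
  proof -
    have "\<bar>c + \<Lambda> \<theta>p\<bar> + 1 \<le> \<theta>p * K" 
      using tight(2) unfolding K_def by (metis max.cobounded1 mult.commute pos_divide_le_eq)
    also have "\<dots> \<le> \<theta>p * x" using that tight(2) by simp
    finally show ?thesis unfolding U_def by auto
  qed
  have Km: "x \<in> U \<theta>m" if "x \<le> - K" for x
  proof -
    have "\<bar>c + \<Lambda> \<theta>m\<bar> + 1 \<le> - \<theta>m * K"
      using tight(4) unfolding K_def by (metis max.cobounded2 mult.commute neg_0_less_iff_less pos_divide_le_eq)
    also have "\<dots> \<le> \<theta>m * x" using that tight(4) by (simp add: mult_le_cancel_left)
      (metis minus_le_iff mult_le_cancel_left_neg mult_minus_right)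
    finally show ?thesis unfolding U_def by auto
  qed
  have "compact (closure A \<inter> {- K..K})" by (intro closed_Int_compact) auto
  moreover have "closure A \<inter> {- K..K} \<subseteq> (\<Union>\<theta>\<in>T. U \<theta>)" using cover by auto
  ultimately obtain C where C: "C \<subseteq> T" "finite C" "closure A \<inter> {- K..K} \<subseteq> (\<Union>\<theta>\<in>C. U \<theta>)"
    using compactE_image U_open by metis
  define D where "D = insert \<theta>p (insert \<theta>m C)"
  have D: "finite D" "D \<subseteq> T" "A \<subseteq> (\<Union>\<theta>\<in>D. U \<theta>)"
  proof -
    show "finite D" "D \<subseteq> T" using C tight unfolding D_def by auto
    show "A \<subseteq> (\<Union>\<theta>\<in>D. U \<theta>)"
    proof
      fix x assume "x \<in> A"
      then show "x \<in> (\<Union>\<theta>\<in>D. U \<theta>)"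
        using C(3) Kp[of x] Km[of x] closure_subset[of A] unfolding D_def
        by (cases "K \<le> x"; cases "x \<le> - K") auto
    qed
  qed
  have "eventually (\<lambda>n. \<forall>\<theta>\<in>D. measure (law n) (U \<theta>) \<le> exp (- (real n * - c'))) sequentially"
    unfolding eventually_ball_finite_distrib[OF D(1)]
    using D(2) c' unfolding U_def c_def by (intro ballI eventually_chernoff) auto
  moreover have "eventually (\<lambda>n. ln (real (card D)) / real n < d - c') sequentially"
    using c' by (intro order_tendstoD(2)[OF lim_const_over_n]) auto
  moreover have "eventually (\<lambda>n. (0::nat) < n) sequentially" by (rule eventually_gt_at_top)
  ultimately have "eventually (\<lambda>n. ereal (1 / real n) * log_prob (measure (law n) A) \<le> ereal d) sequentially"
  proof eventually_elim
    fix n :: nat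
    assume *: "\<forall>\<theta>\<in>D. measure (law n) (U \<theta>) \<le> exp (- (real n * - c'))"
      "ln (real (card D)) / real n < d - c'" "0 < n"
    interpret L: prob_space "law n" by (intro prob_space_distr) simp
    have card: "0 < card D" using D(1) by (auto simp: D_def card_gt_0_iff)
    have "measure (law n) A \<le> measure (law n) (\<Union>\<theta>\<in>D. U \<theta>)"
      using D U_open by (intro L.finite_measure_mono) auto
    also have "\<dots> \<le> (\<Sum>\<theta>\<in>D. measure (law n) (U \<theta>))"
      using D(1) U_open by (intro L.finite_measure_subadditive_finite) auto
    also have "\<dots> \<le> (\<Sum>\<theta>\<in>D. exp (real n * c'))" using *(1) by (intro sum_mono) auto
    also have "\<dots> = exp (ln (real (card D)) + real n * c')"
      using card by (simp add: exp_add)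
    also have "\<dots> \<le> exp (real n * d)" using *(2,3) by (simp add: field_simps)
    finally show "ereal (1 / real n) * log_prob (measure (law n) A) \<le> ereal d"
      using *(3) by (simp add: ereal_scale_le_iff log_prob_le_iff)
  qed
  then have "?L \<le> ereal d" by (rule Limsup_bounded)
  with d(2) show False by simp
qed

section \<open>Lower bound: exponential tilting at exposed points\<close>

text \<open>That \<open>\<Lambda>\<close> is differentiable at \<open>\<theta>\<close> with derivative \<open>x\<close>, weakened to one suitable point on
  each side of \<open>\<theta>\<close>.\<close>

definition exposes :: "real \<Rightarrow> real \<Rightarrow> bool" where
  "exposes \<theta> x \<longleftrightarrow> \<theta> \<in> T \<and> (\<forall>\<delta>>0.
     (\<exists>\<eta>\<in>T. \<theta> < \<eta> \<and> \<Lambda> \<eta> - \<Lambda> \<theta> < (\<eta> - \<theta>) * (x + \<delta>)) \<and>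
     (\<exists>\<eta>\<in>T. \<eta> < \<theta> \<and> \<Lambda> \<eta> - \<Lambda> \<theta> < (\<eta> - \<theta>) * (x - \<delta>)))"

text \<open>Under the law with density \<open>exp (\<theta> * S n) / mgf n \<theta>\<close>, the
  sequence is the Markov bound for the event \<open>(\<eta> - \<theta>) * S n \<ge> n * b\<close>.
  Its exponential rate is \<open>\<Lambda> \<eta> - \<Lambda> \<theta> - b\<close>, which is
  negative.\<close>

lemma tilted_tail_tendsto_0:
  assumes "\<theta> \<in> T" "\<eta> \<in> T" "\<Lambda> \<eta> - \<Lambda> \<theta> < b"
  shows "(\<lambda>n. exp (- (real n * b)) * mgf n \<eta> / mgf n \<theta>) \<longlonglongrightarrow> 0"
proof -
  have "(\<lambda>n. - b + (ln (mgf n \<eta>) / real n - ln (mgf n \<theta>) / real n)) \<longlonglongrightarrow> - b + (\<Lambda> \<eta> - \<Lambda> \<theta>)"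
    by (intro tendsto_intros log_mgf_tendsto assms)
  then have "filterlim (\<lambda>n. (- b + (ln (mgf n \<eta>) / real n - ln (mgf n \<theta>) / real n)) * real n) at_bot sequentially"
    using assms(3) by (intro filterlim_tendsto_neg_mult_at_bot filterlim_real_sequentially) auto
  then have "(\<lambda>n. exp ((- b + (ln (mgf n \<eta>) / real n - ln (mgf n \<theta>) / real n)) * real n)) \<longlonglongrightarrow> 0"
    by (rule filterlim_compose[OF exp_at_bot])
  then show ?thesis
  proof (rule Lim_transform_eventually)
    show "eventually (\<lambda>n. exp ((- b + (ln (mgf n \<eta>) / real n - ln (mgf n \<theta>) / real n)) * real n) =
        exp (- (real n * b)) * mgf n \<eta> / mgf n \<theta>) sequentially"
      using eventually_gt_at_top[of 0]
    proof eventually_elim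
      case (elim n)
      then have "(- b + (ln (mgf n \<eta>) / real n - ln (mgf n \<theta>) / real n)) * real n
          = - (real n * b) + ln (mgf n \<eta>) - ln (mgf n \<theta>)" by (simp add: field_simps)
      then have "exp ((- b + (ln (mgf n \<eta>) / real n - ln (mgf n \<theta>) / real n)) * real n)
          = exp (- (real n * b) + ln (mgf n \<eta>) - ln (mgf n \<theta>))" by (rule arg_cong)
      also have "\<dots> = exp (- (real n * b)) * mgf n \<eta> / mgf n \<theta>"
        unfolding exp_diff exp_add using mgf_pos assms by (simp only: exp_ln)
      finally show ?case .
    qed
  qed
qed

text \<open>The tilted law concentrates near \<open>x\<close>, so the interval keeps at least half
  of its mass; on the interval the density is at most \<open>exp (n * (\<theta> * x +
  \<bar>\<theta>\<bar> * \<delta>)) / mgf n \<theta>\<close>, which bounds the cost of undoing the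
  tilt. The tilted measure itself is never constructed: a pointwise inequality is integrated
  instead.\<close>

lemma tilted_lower_bound:
  assumes "exposes \<theta> x" "0 < \<delta>" "0 < \<epsilon>"
  shows "eventually (\<lambda>n. exp (- (real n * (\<theta> * x - \<Lambda> \<theta> + \<bar>\<theta>\<bar> * \<delta> + \<epsilon>)))
           \<le> measure (law n) {x - \<delta><..<x + \<delta>}) sequentially"
proof -
  have th: "\<theta> \<in> T" using assms(1) by (simp add: exposes_def)
  obtain \<eta> where \<eta>: "\<eta> \<in> T" "\<theta> < \<eta>" "\<Lambda> \<eta> - \<Lambda> \<theta> < (\<eta> - \<theta>) * (x + \<delta>)"
    using assms(1,2) by (auto simp: exposes_def)
  obtain \<zeta> where \<zeta>: "\<zeta> \<in> T" "\<zeta> < \<theta>" "\<Lambda> \<zeta> - \<Lambda> \<theta> < (\<zeta> - \<theta>) * (x - \<delta>)"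
    using assms(1,2) by (auto simp: exposes_def)
  \<comment> \<open>\<open>?r\<close> and \<open>?q\<close> bound the tilted mass to the right of
    \<open>x + \<delta>\<close> and to the left of \<open>x - \<delta>\<close>.\<close>
  let ?r = "\<lambda>n. exp (- (real n * ((\<eta> - \<theta>) * (x + \<delta>)))) * mgf n \<eta> / mgf n \<theta>"
  let ?q = "\<lambda>n. exp (- (real n * ((\<zeta> - \<theta>) * (x - \<delta>)))) * mgf n \<zeta> / mgf n \<theta>"
  have "eventually (\<lambda>n. ?r n < 1 / 4) sequentially"
    using tilted_tail_tendsto_0[OF th \<eta>(1,3)] by (intro order_tendstoD) auto
  moreover have "eventually (\<lambda>n. ?q n < 1 / 4) sequentially"
    using tilted_tail_tendsto_0[OF th \<zeta>(1,3)] by (intro order_tendstoD) auto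
  \<comment> \<open>One half of \<epsilon> pays for the convergence of the logarithm of the moment
    generating function, the other for the factor 2 that comes from keeping only half of the tilted
    mass.\<close>
  moreover have "eventually (\<lambda>n. \<Lambda> \<theta> - \<epsilon> / 2 < ln (mgf n \<theta>) / real n) sequentially"
    using log_mgf_tendsto[OF th] assms(3) by (intro order_tendstoD) auto
  moreover have "eventually (\<lambda>n. ln 2 / real n < \<epsilon> / 2) sequentially"
    using assms(3) by (intro order_tendstoD(2)[OF lim_const_over_n]) auto
  moreover have "eventually (\<lambda>n. (0::nat) < n) sequentially" by (rule eventually_gt_at_top)
  ultimately show ?thesis
  proof eventually_elim
    fix n :: nat
    assume r: "?r n < 1 / 4" and q: "?q n < 1 / 4"
      and mg: "\<Lambda> \<theta> - \<epsilon> / 2 < ln (mgf n \<theta>) / real n" and two: "ln 2 / real n < \<epsilon> / 2" and n: "0 < n"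
    let ?G = "{\<omega> \<in> space M. S n \<omega> / real n \<in> {x - \<delta><..<x + \<delta>}}"
    let ?e = "exp (real n * (\<theta> * x + \<bar>\<theta>\<bar> * \<delta>))"
    have pos: "0 < mgf n \<theta>" by (rule mgf_pos[OF th])
    \<comment> \<open>Each of the three summands dominates the left-hand side on one of the regions
      inside, right and left of the interval, and is nonnegative elsewhere.\<close>
    have pw: "exp (\<theta> * S n \<omega>) \<le> ?e * indicator ?G \<omega>
        + exp (- (real n * ((\<eta> - \<theta>) * (x + \<delta>)))) * exp (\<eta> * S n \<omega>)
        + exp (- (real n * ((\<zeta> - \<theta>) * (x - \<delta>)))) * exp (\<zeta> * S n \<omega>)" (is "_ \<le> ?a + ?b + ?c")
      if "\<omega> \<in> space M" for \<omega>
    proof -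
      define y where "y = S n \<omega> / real n"
      have S: "S n \<omega> = real n * y" using n by (simp add: y_def)
      consider "x + \<delta> \<le> y" | "y \<le> x - \<delta>" | "x - \<delta> < y" "y < x + \<delta>" by linarith
      then show ?thesis
      proof cases
        case 1
        have "real n * ((\<eta> - \<theta>) * (x + \<delta>)) \<le> real n * ((\<eta> - \<theta>) * y)"
          using 1 \<eta>(2) by (intro mult_left_mono) auto
        then have "\<theta> * S n \<omega> \<le> - (real n * ((\<eta> - \<theta>) * (x + \<delta>))) + \<eta> * S n \<omega>"
          by (simp add: S algebra_simps)
        then have "exp (\<theta> * S n \<omega>) \<le> ?b" by (simp add: mult_exp_exp)
        moreover have "0 \<le> ?a" "0 \<le> ?c" by (simp_all add: indicator_def)
        ultimately show ?thesis by linarith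
      next
        case 2
        have "real n * ((\<theta> - \<zeta>) * y) \<le> real n * ((\<theta> - \<zeta>) * (x - \<delta>))"
          using 2 \<zeta>(2) by (intro mult_left_mono) auto
        then have "\<theta> * S n \<omega> \<le> - (real n * ((\<zeta> - \<theta>) * (x - \<delta>))) + \<zeta> * S n \<omega>"
          by (simp add: S algebra_simps)
        then have "exp (\<theta> * S n \<omega>) \<le> ?c" by (simp add: mult_exp_exp)
        moreover have "0 \<le> ?a" "0 \<le> ?b" by (simp_all add: indicator_def)
        ultimately show ?thesis by linarith
      next
        case 3
        have "\<theta> * (y - x) \<le> \<bar>\<theta>\<bar> * \<bar>y - x\<bar>" by (metis abs_ge_self abs_mult)
        also have "\<dots> \<le> \<bar>\<theta>\<bar> * \<delta>" using 3 by (intro mult_left_mono) auto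
        finally have "real n * (\<theta> * y) \<le> real n * (\<theta> * x + \<bar>\<theta>\<bar> * \<delta>)"
          by (intro mult_left_mono) (auto simp: algebra_simps)
        moreover have "\<omega> \<in> ?G" using that 3 by (simp add: y_def)
        ultimately have "exp (\<theta> * S n \<omega>) \<le> ?a" by (simp add: S mult.left_commute)
        moreover have "0 \<le> ?b" "0 \<le> ?c" by simp_all
        ultimately show ?thesis by linarith
      qed
    qed
    have [measurable]: "?G \<in> sets M" by measurable
    have "mgf n \<theta> \<le> expectation (\<lambda>\<omega>. ?e * indicator ?G \<omega>
        + exp (- (real n * ((\<eta> - \<theta>) * (x + \<delta>)))) * exp (\<eta> * S n \<omega>)
        + exp (- (real n * ((\<zeta> - \<theta>) * (x - \<delta>)))) * exp (\<zeta> * S n \<omega>))"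
      using pw by (intro integral_mono integrable_exp th \<eta> \<zeta> Bochner_Integration.integrable_add
          integrable_mult_right) (auto simp: less_top[symmetric])
    also have "\<dots> = ?e * prob ?G
        + exp (- (real n * ((\<eta> - \<theta>) * (x + \<delta>)))) * mgf n \<eta>
        + exp (- (real n * ((\<zeta> - \<theta>) * (x - \<delta>)))) * mgf n \<zeta>"
      by (subst Bochner_Integration.integral_add Bochner_Integration.integral_mult_right_zero;
          auto simp: less_top[symmetric] integrable_exp th \<eta> \<zeta>
          intro!: Bochner_Integration.integrable_add integrable_mult_right)+
    also have "\<dots> = ?e * prob ?G + mgf n \<theta> * (?r n + ?q n)" using pos by (simp add: field_simps)
    also have "\<dots> \<le> ?e * prob ?G + mgf n \<theta> * (1 / 4 + 1 / 4)"
      using pos by (intro add_left_mono mult_left_mono add_mono less_imp_le[OF r] less_imp_le[OF q]) auto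
    finally have "mgf n \<theta> \<le> 2 * (?e * prob ?G)" by simp
    moreover have "exp (real n * (\<Lambda> \<theta> - \<epsilon> / 2)) \<le> mgf n \<theta>"
    proof -
      have "real n * (\<Lambda> \<theta> - \<epsilon> / 2) \<le> ln (mgf n \<theta>)" using mg n by (simp add: field_simps)
      then show ?thesis using pos by (metis exp_le_cancel_iff exp_ln)
    qed
    moreover have "2 \<le> exp (real n * (\<epsilon> / 2))"
    proof -
      have "ln 2 \<le> real n * (\<epsilon> / 2)" using two n by (simp add: field_simps)
      then show ?thesis by (metis exp_le_cancel_iff exp_ln zero_less_numeral)
    qed
    moreover have "2 * (?e * prob ?G) \<le> exp (real n * (\<epsilon> / 2)) * (?e * prob ?G)" if "2 \<le> exp (real n * (\<epsilon> / 2))"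
      using that by (rule mult_right_mono) simp
    ultimately have "exp (real n * (\<Lambda> \<theta> - \<epsilon> / 2)) \<le> exp (real n * (\<epsilon> / 2)) * (?e * prob ?G)"
      by linarith
    then have "exp (real n * (\<Lambda> \<theta> - \<epsilon> / 2)) / (exp (real n * (\<epsilon> / 2)) * ?e) \<le> prob ?G"
      by (simp add: pos_divide_le_eq mult.commute mult.left_commute)
    also have "exp (real n * (\<Lambda> \<theta> - \<epsilon> / 2)) / (exp (real n * (\<epsilon> / 2)) * ?e)
        = exp (- (real n * (\<theta> * x - \<Lambda> \<theta> + \<bar>\<theta>\<bar> * \<delta> + \<epsilon>)))"
      by (simp add: exp_add[symmetric] exp_diff[symmetric]) (simp add: field_simps)
    finally show "exp (- (real n * (\<theta> * x - \<Lambda> \<theta> + \<bar>\<theta>\<bar> * \<delta> + \<epsilon>)))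
           \<le> measure (law n) {x - \<delta><..<x + \<delta>}"
      by (simp add: measure_law)
  qed
qed

lemma liminf_exposed_ge:
  assumes A: "A \<in> sets borel" and x: "x \<in> interior A" and ex: "exposes \<theta> x"
  shows "ereal (- (\<theta> * x - \<Lambda> \<theta>)) \<le> liminf (\<lambda>n. ereal (1 / real n) * log_prob (measure (law n) A))"
proof (rule ccontr)
  let ?L = "liminf (\<lambda>n. ereal (1 / real n) * log_prob (measure (law n) A))"
  assume "\<not> ?thesis"
  then have "?L < ereal (- (\<theta> * x - \<Lambda> \<theta>))" by (simp only: not_le)
  from ereal_dense2[OF this] obtain d where d: "?L < ereal d" "d < - (\<theta> * x - \<Lambda> \<theta>)" by auto
  \<comment> \<open>Half of the gap above \<open>d\<close>: the term
    \<open>\<bar>\<theta>\<bar> * \<delta>\<close> and the error \<epsilon> of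
    \<open>tilted_lower_bound\<close> each use at most one half. The \<open>+ 1\<close> in the
    denominator of \<delta> below allows \<theta> to be 0.\<close>
  define \<epsilon> where "\<epsilon> = (- (\<theta> * x - \<Lambda> \<theta>) - d) / 2"
  have \<epsilon>: "0 < \<epsilon>" using d(2) by (simp add: \<epsilon>_def)
  obtain e where e: "0 < e" "ball x e \<subseteq> interior A"
    using x open_interior openE by metis
  define \<delta> where "\<delta> = min e (\<epsilon> / (\<bar>\<theta>\<bar> + 1))"
  have \<delta>: "0 < \<delta>" using e \<epsilon> by (simp add: \<delta>_def)
  have "\<bar>\<theta>\<bar> * \<delta> \<le> \<bar>\<theta>\<bar> * (\<epsilon> / (\<bar>\<theta>\<bar> + 1))" by (intro mult_left_mono) (auto simp: \<delta>_def)
  also have "\<dots> \<le> \<epsilon>" using \<epsilon> by (simp add: field_simps)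
  finally have \<delta>\<epsilon>: "\<bar>\<theta>\<bar> * \<delta> \<le> \<epsilon>" .
  have sub: "{x - \<delta><..<x + \<delta>} \<subseteq> A"
    using e(2) interior_subset[of A] by (force simp: \<delta>_def ball_eq_greaterThanLessThan)
  from tilted_lower_bound[OF ex \<delta> \<epsilon>] eventually_gt_at_top[of 0]
  have "eventually (\<lambda>n. ereal d \<le> ereal (1 / real n) * log_prob (measure (law n) A)) sequentially"
  proof eventually_elim
    fix n :: nat
    assume *: "exp (- (real n * (\<theta> * x - \<Lambda> \<theta> + \<bar>\<theta>\<bar> * \<delta> + \<epsilon>))) \<le> measure (law n) {x - \<delta><..<x + \<delta>}"
      and n: "0 < n"
    interpret L: prob_space "law n" by (intro prob_space_distr) simp
    have "d \<le> - (\<theta> * x - \<Lambda> \<theta> + \<bar>\<theta>\<bar> * \<delta> + \<epsilon>)" using \<delta>\<epsilon> by (simp add: \<epsilon>_def field_simps)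
    then have "real n * d \<le> real n * - (\<theta> * x - \<Lambda> \<theta> + \<bar>\<theta>\<bar> * \<delta> + \<epsilon>)"
      by (intro mult_left_mono) auto
    then have "exp (real n * d) \<le> exp (- (real n * (\<theta> * x - \<Lambda> \<theta> + \<bar>\<theta>\<bar> * \<delta> + \<epsilon>)))"
      unfolding mult_minus_right exp_le_cancel_iff .
    also note *
    also have "measure (law n) {x - \<delta><..<x + \<delta>} \<le> measure (law n) A"
      using sub A by (intro L.finite_measure_mono) auto
    finally show "ereal d \<le> ereal (1 / real n) * log_prob (measure (law n) A)"
      using n by (simp add: ereal_scale_le_iff log_prob_ge_iff)
  qed
  then have "ereal d \<le> ?L" by (rule Liminf_bounded)
  with d(1) show False by simp
qed

section \<open>The large deviation principle from both bounds\<close>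

lemma lower_semicontinuous_rate: "lower_semicontinuous rate"
  unfolding lower_semicontinuous_def
proof
  fix c :: ereal
  have "{x. c < rate x} = (\<Union>\<theta>\<in>T. {x. c < ereal (\<theta> * x - \<Lambda> \<theta>)})"
    by (auto simp: rate_def less_SUP_iff)
  also have "open \<dots>"
    by (intro open_UN ballI open_Collect_less continuous_intros)
  finally show "open {x. c < rate x}" .
qed

text \<open>The tilts \<open>\<theta>p\<close> and \<open>\<theta>m\<close> give exponential
  tightness, and \<open>0\<close> makes \<open>rate\<close> nonnegative. By \<open>dense\<close>, a
  point of finite rate need not be exposed itself: exposed points arbitrarily near it, at almost the
  same cost, suffice for the lower bound on open sets.\<close>

theorem satisfies_LDP_rate:
  assumes tight: "\<theta>p \<in> T" "0 < \<theta>p" "\<theta>m \<in> T" "\<theta>m < 0"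
    and zero: "0 \<in> T" "\<Lambda> 0 = 0"
    and dense: "\<And>x U c. open U \<Longrightarrow> x \<in> U \<Longrightarrow> rate x < ereal c \<Longrightarrow>
      \<exists>\<theta>. \<exists>y\<in>U. exposes \<theta> y \<and> \<theta> * y - \<Lambda> \<theta> \<le> c"
  shows "satisfies_LDP law real rate"
  unfolding satisfies_LDP_def
proof (intro conjI allI impI ballI)
  show "prob_space (law n)" for n by (intro prob_space_distr) simp
  show "sets (law n) = sets borel" for n by simp
  show "0 < real n" if "1 \<le> n" for n using that by simp
  show "mono_on {1..} real" by (simp add: mono_on_def)
  show "filterlim real at_top sequentially" by (rule filterlim_real_sequentially)
  show "0 \<le> rate x" for x
    unfolding rate_def using zero by (intro SUP_upper2[of 0]) auto
  show "lower_semicontinuous rate" by (rule lower_semicontinuous_rate)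
  fix A :: "real set" assume A: "A \<in> sets borel"
  show "limsup (\<lambda>n. ereal (1 / real n) * log_prob (measure (law n) A)) \<le> - (INF x\<in>closure A. rate x)"
    by (rule limsup_closure_le[OF A tight])
  let ?L = "liminf (\<lambda>n. ereal (1 / real n) * log_prob (measure (law n) A))"
  have "- ?L \<le> rate x" if x: "x \<in> interior A" for x
  proof (rule ccontr)
    assume "\<not> - ?L \<le> rate x"
    then have "rate x < - ?L" by (simp only: not_le)
    from ereal_dense2[OF this] obtain c where c: "rate x < ereal c" "ereal c < - ?L" by blast
    obtain \<theta> y where y: "y \<in> interior A" "exposes \<theta> y" "\<theta> * y - \<Lambda> \<theta> \<le> c"
      using dense[OF open_interior x c(1)] by blast
    have "ereal (- c) \<le> ereal (- (\<theta> * y - \<Lambda> \<theta>))" using y(3) by simp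
    also have "\<dots> \<le> ?L" by (rule liminf_exposed_ge[OF A y(1,2)])
    finally have "- ?L \<le> ereal c" using ereal_uminus_le_reorder[of ?L "ereal c"] by simp
    with c(2) show False by simp
  qed
  then have "- ?L \<le> (INF x\<in>interior A. rate x)" by (intro INF_greatest)
  then show "- (INF x\<in>interior A. rate x) \<le> ?L"
    using ereal_uminus_le_reorder[of ?L "INF x\<in>interior A. rate x"] by simp
qed

end

section \<open>The equation for \<open>g\<close>\<close>

lemma exp_tangent_less:
  fixes u v :: real
  assumes "u \<noteq> v"
  shows "exp v * (1 + (u - v)) < exp u"
proof -
  have "1 + (u - v) < exp (u - v)" using assms exp_minus_greater[of "v - u"] by simp
  then have "exp v * (1 + (u - v)) < exp v * exp (u - v)" by simp
  also have "\<dots> = exp u" by (simp add: exp_add[symmetric])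
  finally show ?thesis .
qed

locale critical_mark = prob_space M for M :: "'a measure" +
  fixes a :: real and m :: "'a \<Rightarrow> real" and xc :: real
  assumes m_measurable [measurable]: "m \<in> borel_measurable M"
    and a_pos: "0 < a"
    and m_pos: "AE \<omega> in M. 0 < m \<omega>"
    and xc_gt_1: "1 < xc"
    and critical: "critical_equation M a m xc"
begin

section \<open>Convexity of \<phi> and monotonicity of \<open>h\<close>\<close>

definition \<phi> :: "real \<Rightarrow> real" where
  "\<phi> y = expectation (\<lambda>\<omega>. exp (a * m \<omega> * (y - 1)))"

text \<open>The derivative of \<phi>, obtained by formally differentiating under the expectation;
  \<open>\<phi>_has_derivative\<close> justifies this up to \<open>xc\<close>.\<close>

definition D :: "real \<Rightarrow> real" where
  "D y = expectation (\<lambda>\<omega>. a * m \<omega> * exp (a * m \<omega> * (y - 1)))"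

text \<open>Solving \<open>y = exp \<theta> * \<phi> y\<close> for \<theta>: \<open>h y\<close> is
  the parameter at which \<open>y\<close> solves the equation of \<open>g\<close>.\<close>

definition h :: "real \<Rightarrow> real" where
  "h y = ln y - ln (\<phi> y)"

text \<open>The critical equation includes integrability at \<open>xc\<close>; as the mark is
  positive, the integrand at \<open>xc\<close> dominates those to its left.\<close>

lemma integrable_exp_mark:
  assumes "y \<le> xc"
  shows "integrable M (\<lambda>\<omega>. exp (a * m \<omega> * (y - 1)))"
proof (rule Bochner_Integration.integrable_bound)
  show "integrable M (\<lambda>\<omega>. exp (a * m \<omega> * (xc - 1)))"
    using critical by (simp add: critical_equation_def)
  show "AE \<omega> in M. norm (exp (a * m \<omega> * (y - 1))) \<le> norm (exp (a * m \<omega> * (xc - 1)))"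
    using m_pos a_pos assms by (auto elim!: eventually_mono)
qed measurable

lemma integrable_mark_exp_mark:
  assumes "y \<le> xc"
  shows "integrable M (\<lambda>\<omega>. a * m \<omega> * exp (a * m \<omega> * (y - 1)))"
proof (rule Bochner_Integration.integrable_bound)
  show "integrable M (\<lambda>\<omega>. a * m \<omega> * exp (a * m \<omega> * (xc - 1)))"
    using critical by (simp add: critical_equation_def)
  show "AE \<omega> in M. norm (a * m \<omega> * exp (a * m \<omega> * (y - 1)))
      \<le> norm (a * m \<omega> * exp (a * m \<omega> * (xc - 1)))"
    using m_pos a_pos assms by (auto elim!: eventually_mono simp: abs_mult)
qed measurable

lemma critical_\<phi>: "\<phi> xc = xc * D xc"
  using critical by (simp add: critical_equation_def \<phi>_def D_def)

lemma \<phi>_pos: "y \<le> xc \<Longrightarrow> 0 < \<phi> y"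
  unfolding \<phi>_def by (intro expectation_greater integrable_exp_mark) auto

lemma \<phi>_1: "\<phi> 1 = 1"
  by (simp add: \<phi>_def prob_space)

text \<open>Strict convexity of \<open>exp\<close>, integrated. Strictness survives because
  \<open>a * m\<close> is positive almost everywhere.\<close>

lemma \<phi>_tangent_less:
  assumes "y \<le> xc" "z \<noteq> y" and int: "integrable M (\<lambda>\<omega>. exp (a * m \<omega> * (z - 1)))"
  shows "\<phi> y + D y * (z - y) < \<phi> z"
proof -
  let ?f = "\<lambda>\<omega>. exp (a * m \<omega> * (z - 1)) - (exp (a * m \<omega> * (y - 1))
      + a * m \<omega> * exp (a * m \<omega> * (y - 1)) * (z - y))"
  note ints = integrable_exp_mark[OF assms(1)] integrable_mark_exp_mark[OF assms(1)] int
  have "0 < expectation ?f"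
  proof (rule expectation_greater)
    show "integrable M ?f" using ints
      by (intro Bochner_Integration.integrable_diff Bochner_Integration.integrable_add
          integrable_mult_left)
    show "AE \<omega> in M. 0 < ?f \<omega>"
      using m_pos
    proof eventually_elim
      case (elim \<omega>)
      then have "a * m \<omega> * (z - 1) \<noteq> a * m \<omega> * (y - 1)" using a_pos assms(2) by simp
      from exp_tangent_less[OF this] show ?case by (simp add: algebra_simps)
    qed
  qed
  also have "expectation ?f = \<phi> z - (\<phi> y + D y * (z - y))"
    unfolding \<phi>_def D_def using ints by simp
  finally show ?thesis by simp
qed

lemma \<phi>_tangent_le: "y \<le> xc \<Longrightarrow> z \<le> xc \<Longrightarrow> \<phi> y + D y * (z - y) \<le> \<phi> z"
  using \<phi>_tangent_less[of y z] integrable_exp_mark[of z] by (cases "z = y") (auto intro: less_imp_le)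

lemma D_pos: "y \<le> xc \<Longrightarrow> 0 < D y"
  unfolding D_def using m_pos a_pos
  by (intro expectation_greater integrable_mark_exp_mark) (auto elim!: eventually_mono)

lemma D_mono: "y \<le> z \<Longrightarrow> z \<le> xc \<Longrightarrow> D y \<le> D z"
  unfolding D_def using m_pos a_pos
  by (intro integral_mono_AE integrable_mark_exp_mark) (auto elim!: eventually_mono)

lemma \<phi>_mono: "y \<le> z \<Longrightarrow> z \<le> xc \<Longrightarrow> \<phi> y \<le> \<phi> z"
proof -
  assume *: "y \<le> z" "z \<le> xc"
  then have "0 \<le> D y * (z - y)" using D_pos[of y] by simp
  with \<phi>_tangent_le[of y z] * show ?thesis by linarith
qed

text \<open>The critical equation says that the tangent of \<open>\<phi>\<close> at \<open>xc\<close> passes through the origin.\<close>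

lemma \<phi>_gt_line:
  assumes "z \<noteq> xc" "integrable M (\<lambda>\<omega>. exp (a * m \<omega> * (z - 1)))"
  shows "D xc * z < \<phi> z"
  using \<phi>_tangent_less[OF order_refl assms] by (simp add: critical_\<phi> algebra_simps)

text \<open>It amounts to \<open>\<phi> z * y < \<phi> y * z\<close>. The tangent of \<phi> at
  \<open>z\<close>, evaluated at \<open>y\<close>, gives this once
  \<open>z * D z \<le> \<phi> z\<close>, and that holds because \<open>D\<close> increases and
  \<phi> lies above its tangent at \<open>xc\<close>, the line \<open>D xc * z\<close> through the
  origin.\<close>

lemma h_strict_mono:
  assumes "0 < y" "y < z" "z \<le> xc"
  shows "h y < h z"
proof -
  have "z * D z \<le> z * D xc" using assms by (intro mult_left_mono D_mono) auto
  also have "\<dots> \<le> \<phi> z"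
    using \<phi>_gt_line[of z] integrable_exp_mark[of z] assms critical_\<phi>
    by (cases "z = xc") (auto simp: mult.commute less_imp_le)
  finally have "z * D z * (z - y) \<le> \<phi> z * (z - y)" using assms by (intro mult_right_mono) auto
  moreover have "(\<phi> z + D z * (y - z)) * z < \<phi> y * z"
    using assms by (intro mult_strict_right_mono \<phi>_tangent_less integrable_exp_mark) auto
  ultimately have "\<phi> z * y < \<phi> y * z" by (simp add: algebra_simps)
  then have "ln (\<phi> z * y) < ln (\<phi> y * z)"
    using \<phi>_pos[of y] \<phi>_pos[of z] assms by simp
  then show ?thesis
    using \<phi>_pos[of y] \<phi>_pos[of z] assms by (simp add: h_def ln_mult)
qed

lemma h_mono: "0 < y \<Longrightarrow> y \<le> z \<Longrightarrow> z \<le> xc \<Longrightarrow> h y \<le> h z"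
  using h_strict_mono[of y z] by (cases "y = z") auto

lemma h_1: "h 1 = 0"
  by (simp add: h_def \<phi>_1)

lemma h_xc: "h xc = \<theta>\<^sub>c M a m xc"
  using xc_gt_1 D_pos[of xc] by (simp add: h_def \<theta>\<^sub>c_def critical_\<phi> ln_mult flip: D_def)

lemma \<theta>\<^sub>c_pos: "0 < \<theta>\<^sub>c M a m xc"
  using h_strict_mono[of 1 xc] xc_gt_1 h_1 h_xc by simp

section \<open>Derivative and range of \<open>h\<close>\<close>

text \<open>Dominated convergence of the difference quotients, which the mean value theorem bounds
  by the integrand of \<open>D xc\<close>. At \<open>xc\<close> the derivative is one-sided, since
  integrability is known only up to there.\<close>

lemma \<phi>_has_derivative:
  assumes "y \<le> xc"
  shows "(\<phi> has_real_derivative D y) (at y within {..xc})"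
  unfolding has_field_derivative_iff tendsto_at_iff_sequentially comp_def
proof (intro allI impI)
  fix z :: "nat \<Rightarrow> real" assume z: "\<forall>i. z i \<in> {..xc} - {y}" "z \<longlonglongrightarrow> y"
  let ?q = "\<lambda>i \<omega>. (exp (a * m \<omega> * (z i - 1)) - exp (a * m \<omega> * (y - 1))) / (z i - y)"
  have "(\<lambda>i. expectation (?q i)) \<longlonglongrightarrow> D y"
    unfolding D_def
  proof (rule integral_dominated_convergence)
    show "integrable M (\<lambda>\<omega>. a * m \<omega> * exp (a * m \<omega> * (xc - 1)))"
      by (rule integrable_mark_exp_mark) simp
    show "AE \<omega> in M. (\<lambda>i. ?q i \<omega>) \<longlonglongrightarrow> a * m \<omega> * exp (a * m \<omega> * (y - 1))"
    proof (rule AE_I2)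
      fix \<omega>
      have "((\<lambda>x. exp (a * m \<omega> * (x - 1))) has_real_derivative a * m \<omega> * exp (a * m \<omega> * (y - 1))) (at y)"
        by (auto intro!: derivative_eq_intros)
      then show "(\<lambda>i. ?q i \<omega>) \<longlonglongrightarrow> a * m \<omega> * exp (a * m \<omega> * (y - 1))"
        using z unfolding has_field_derivative_iff tendsto_at_iff_sequentially comp_def by auto
    qed
    show "AE \<omega> in M. norm (?q i \<omega>) \<le> a * m \<omega> * exp (a * m \<omega> * (xc - 1))" for i
      using m_pos
    proof eventually_elim
      case (elim \<omega>)
      define w where "w = a * m \<omega>"
      have w: "0 < w" using elim a_pos by (simp add: w_def)
      have zi: "z i \<le> xc" "z i \<noteq> y" using z by auto
      have "\<bar>exp (w * (z i - 1)) - exp (w * (y - 1))\<bar> \<le> w * exp (w * (xc - 1)) * \<bar>z i - y\<bar>"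
      proof -
        have "norm (exp (w * (z i - 1)) - exp (w * (y - 1))) \<le> w * exp (w * (xc - 1)) * norm (z i - y)"
        proof (rule differentiable_bound[where S = "{..xc}"])
          show "convex {..xc}" by simp
          show "((\<lambda>x. exp (w * (x - 1))) has_derivative (\<lambda>u. u * (w * exp (w * (x - 1))))) (at x within {..xc})"
            if "x \<in> {..xc}" for x
            by (auto intro!: derivative_eq_intros)
          show "onorm (\<lambda>u. u * (w * exp (w * (x - 1)))) \<le> w * exp (w * (xc - 1))" if "x \<in> {..xc}" for x
            using w that by (intro onorm_le) (auto simp: abs_mult mult.commute intro!: mult_left_mono)
        qed (use zi assms in auto)
        then show ?thesis by simp
      qed
      then show ?case using zi unfolding w_def by (simp add: field_simps abs_mult)
    qed
  qed measurable
  also have "(\<lambda>i. expectation (?q i)) = (\<lambda>i. (\<phi> (z i) - \<phi> y) / (z i - y))"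
    using z integrable_exp_mark assms by (auto simp: \<phi>_def)
  finally show "(\<lambda>i. (\<phi> (z i) - \<phi> y) / (z i - y)) \<longlonglongrightarrow> D y" .
qed

lemma continuous_on_\<phi>: "continuous_on {..xc} \<phi>"
  unfolding continuous_on_eq_continuous_within
  using \<phi>_has_derivative DERIV_continuous by blast

lemma h_has_derivative:
  assumes "0 < y" "y \<le> xc"
  shows "(h has_real_derivative (1 / y - D y / \<phi> y)) (at y within {..xc})"
  unfolding h_def[abs_def] using assms \<phi>_pos[of y]
  by (auto intro!: derivative_eq_intros \<phi>_has_derivative)

lemma continuous_on_h: "continuous_on {0<..xc} h"
  unfolding h_def[abs_def] using \<phi>_pos
  by (intro continuous_intros continuous_on_subset[OF continuous_on_\<phi>]) (fastforce dest: \<phi>_pos)+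

text \<open>As \<open>y\<close> decreases to 0, \<open>ln y\<close> tends to minus infinity while
  \<open>\<phi> y\<close> stays above \<open>\<phi> 0 > 0\<close>. The witness solves
  \<open>ln y - ln (\<phi> 0) = c\<close>, cut off at 1.\<close>

lemma h_le_near_0:
  obtains y\<^sub>0 where "0 < y\<^sub>0" "y\<^sub>0 \<le> 1" "\<And>y. 0 < y \<Longrightarrow> y \<le> y\<^sub>0 \<Longrightarrow> h y \<le> c"
proof
  show "0 < min 1 (exp (c + ln (\<phi> 0)))" "min 1 (exp (c + ln (\<phi> 0))) \<le> 1" by auto
  fix y :: real assume y: "0 < y" "y \<le> min 1 (exp (c + ln (\<phi> 0)))"
  have "ln y \<le> ln (exp (c + ln (\<phi> 0)))" using y by (subst ln_le_cancel_iff) auto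
  then have "ln y \<le> c + ln (\<phi> 0)" by simp
  moreover have "ln (\<phi> 0) \<le> ln (\<phi> y)" using y xc_gt_1 \<phi>_mono[of 0 y] \<phi>_pos[of 0] \<phi>_pos[of y] by simp
  ultimately show "h y \<le> c" by (simp add: h_def)
qed

lemma h_surj:
  assumes "\<theta> \<le> h xc"
  obtains y where "0 < y" "y \<le> xc" "h y = \<theta>"
proof -
  obtain y\<^sub>0 where y: "0 < y\<^sub>0" "y\<^sub>0 \<le> 1" "h y\<^sub>0 \<le> \<theta>" by (rule h_le_near_0[of \<theta>]) auto
  have "continuous_on {y\<^sub>0..xc} h" using y by (intro continuous_on_subset[OF continuous_on_h]) auto
  then obtain x where "y\<^sub>0 \<le> x" "x \<le> xc" "h x = \<theta>"
    using IVT'[of h y\<^sub>0 \<theta> xc] y assms xc_gt_1 by auto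
  with y show thesis by (intro that[of x]) auto
qed

section \<open>\<open>g\<close> as the inverse of \<open>h\<close>\<close>

lemma g_equation_iff:
  "g_equation M a m \<theta> x \<longleftrightarrow>
     integrable M (\<lambda>\<omega>. exp (a * m \<omega> * (x - 1))) \<and> x = exp \<theta> * \<phi> x"
  by (simp add: g_equation_def \<phi>_def exp_add)

lemma g_equation_iff_h:
  assumes "0 < x" "x \<le> xc"
  shows "g_equation M a m \<theta> x \<longleftrightarrow> h x = \<theta>"
proof -
  have "h x = \<theta> \<longleftrightarrow> ln x = ln (exp \<theta> * \<phi> x)"
    using \<phi>_pos[of x] assms by (auto simp: h_def ln_mult)
  also have "\<dots> \<longleftrightarrow> x = exp \<theta> * \<phi> x" using \<phi>_pos[of x] assms by simp
  finally show ?thesis using assms by (simp add: g_equation_iff integrable_exp_mark)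
qed

text \<open>Every solution is positive, being a positive factor times a positive expectation. One
  below \<open>y\<close> would lie in the range where \<open>h\<close> is injective and have the
  same value of \<open>h\<close> as \<open>y\<close>.\<close>

lemma minimal_solution_h:
  assumes "0 < y" "y \<le> xc"
  shows "minimal_solution (g_equation M a m (h y)) y"
  unfolding minimal_solution_def
proof (intro conjI allI impI)
  show "g_equation M a m (h y) y" using assms by (simp add: g_equation_iff_h)
  fix z assume z: "g_equation M a m (h y) z"
  then have "z = exp (h y) * \<phi> z" "0 < \<phi> z"
    using expectation_greater[of "\<lambda>\<omega>. exp (a * m \<omega> * (z - 1))" 0]
    by (simp_all add: g_equation_iff \<phi>_def)
  then have "0 < z" by (metis exp_gt_zero mult_pos_pos)
  show "y \<le> z"
  proof (rule ccontr)
    assume "\<not> y \<le> z"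
    with h_strict_mono[of z y] assms \<open>0 < z\<close> z show False by (auto simp: g_equation_iff_h)
  qed
qed

lemma g_h:
  assumes "0 < y" "y \<le> xc"
  shows "g M a m (h y) = y"
  unfolding g_def
  using minimal_solution_h[OF assms] by (intro the_equality) (auto simp: minimal_solution_def intro: antisym)

lemma minimal_solution_g:
  assumes "\<theta> \<le> h xc"
  shows "minimal_solution (g_equation M a m \<theta>) (g M a m \<theta>)"
  using h_surj[OF assms] g_h minimal_solution_h by metis

lemma g_solution:
  assumes "\<theta> \<le> h xc"
  shows "0 < g M a m \<theta>" "g M a m \<theta> \<le> xc" "h (g M a m \<theta>) = \<theta>"
  using h_surj[OF assms] g_h by metis+

section \<open>Steepness at the critical point\<close>

text \<open>The conclusions are the two inequalities of \<open>exposes\<close>, written in the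
  variable \<open>y = g \<theta>\<close>, in which the cumulant function is affine. The point
  \<open>y\<close> maximises \<open>x * h y - \<nu> * y\<close>; there
  \<open>x * h' = \<nu>\<close>, so replacing \<open>x\<close> by \<open>x + \<delta>\<close> or
  \<open>x - \<delta>\<close> tilts the function strictly up or down.\<close>

lemma ex_exposing_point:
  assumes "0 < x" "0 < \<nu>"
  obtains y where "0 < y" "y < xc"
    "\<And>\<delta>. 0 < \<delta> \<Longrightarrow> \<exists>z>y. z \<le> xc \<and> \<nu> * (z - y) < (h z - h y) * (x + \<delta>)"
    "\<And>\<delta>. 0 < \<delta> \<Longrightarrow> \<exists>z<y. 0 < z \<and> \<nu> * (z - y) < (h z - h y) * (x - \<delta>)"
proof -
  let ?f = "\<lambda>b y. b * h y - \<nu> * y"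
  have deriv: "(?f b has_real_derivative (b * (1 / y - D y / \<phi> y) - \<nu>)) (at y within {..xc})"
    if "0 < y" "y \<le> xc" for b y
    using that by (auto intro!: derivative_eq_intros h_has_derivative)
  \<comment> \<open>Left of this point the function stays below its value at \<open>xc\<close>, so a
    maximum over the compact interval from here to \<open>xc\<close> is one over all of
    \<open>(0, xc]\<close>.\<close>
  obtain y\<^sub>0 where y0: "0 < y\<^sub>0" "y\<^sub>0 \<le> 1"
      "\<And>y. 0 < y \<Longrightarrow> y \<le> y\<^sub>0 \<Longrightarrow> h y \<le> ?f x xc / x"
    by (rule h_le_near_0) blast
  have small: "?f x y < ?f x xc" if "0 < y" "y \<le> y\<^sub>0" for y
  proof -
    have "x * h y \<le> ?f x xc" using y0(3)[OF that] assms by (simp add: field_simps)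
    moreover have "0 < \<nu> * y" using assms that by simp
    ultimately show ?thesis by linarith
  qed
  have "continuous_on {y\<^sub>0..xc} (?f x)"
    using y0 by (intro continuous_intros continuous_on_subset[OF continuous_on_h]) auto
  then obtain y where y: "y \<in> {y\<^sub>0..xc}" "\<And>z. z \<in> {y\<^sub>0..xc} \<Longrightarrow> ?f x z \<le> ?f x y"
    using continuous_attains_sup[of "{y\<^sub>0..xc}" "?f x"] y0 xc_gt_1 by auto
  have y_pos: "0 < y" using y y0 by auto
  have max: "?f x z \<le> ?f x y" if "0 < z" "z \<le> xc" for z
    using y(2)[of z] y(2)[of xc] small[of z] that y0 xc_gt_1 by (cases "z \<le> y\<^sub>0") auto
  \<comment> \<open>By the critical equation \<open>h\<close> has derivative 0 at \<open>xc\<close>,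
    hence \<open>?f x\<close> has slope \<open>- \<nu>\<close> there and is larger slightly to the
    left.\<close>
  have "y \<noteq> xc"
  proof
    assume "y = xc"
    have "xc > 0" using xc_gt_1 by simp
    moreover have "1 / xc - D xc / \<phi> xc = 0" using xc_gt_1 D_pos[of xc] by (simp add: critical_\<phi>)
    ultimately have "(?f x has_real_derivative - \<nu>) (at xc within {..xc})" using deriv[of xc x] by simp
    from has_real_derivative_neg_dec_left[OF this] assms obtain d
      where d: "0 < d" "\<And>e. 0 < e \<Longrightarrow> xc - e \<in> {..xc} \<Longrightarrow> e < d \<Longrightarrow> ?f x xc < ?f x (xc - e)" by auto
    define e where "e = min (d / 2) (xc / 2)"
    have "0 < e" "e < d" "e < xc" using d xc_gt_1 by (auto simp: e_def)
    then show False using d(2)[of e] max[of "xc - e"] \<open>y = xc\<close> by auto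
  qed
  with y have y_less: "y < xc" by auto
  define h' where "h' = 1 / y - D y / \<phi> y"
  have deriv': "(?f b has_real_derivative (b * h' - \<nu>)) (at y)" for b
  proof -
    have "(?f b has_real_derivative (b * h' - \<nu>)) (at y within {..<xc})"
      unfolding h'_def by (rule DERIV_subset[OF deriv]) (use y_pos y_less in auto)
    then show ?thesis using at_within_open[of y "{..<xc}"] y_less by simp
  qed
  have "x * h' - \<nu> = 0"
  proof (rule DERIV_local_max[OF deriv'])
    show "0 < min y (xc - y)" using y_pos y_less by simp
    show "\<forall>z. \<bar>y - z\<bar> < min y (xc - y) \<longrightarrow> ?f x z \<le> ?f x y" by (intro allI impI max) auto
  qed
  then have h': "x * h' = \<nu>" "0 < h'" using assms by (auto simp: zero_less_mult_iff)
  show thesis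
  proof (rule that[OF y_pos y_less])
    fix \<delta> :: real assume \<delta>: "0 < \<delta>"
    have "(?f (x + \<delta>) has_real_derivative \<delta> * h') (at y)"
      using deriv'[of "x + \<delta>"] h' by (simp add: algebra_simps)
    from has_real_derivative_pos_inc_right[OF this] \<delta> h' obtain d
      where d: "0 < d" "\<And>e. 0 < e \<Longrightarrow> e < d \<Longrightarrow> ?f (x + \<delta>) y < ?f (x + \<delta>) (y + e)" by auto
    define e where "e = min (d / 2) ((xc - y) / 2)"
    have "0 < e" "e < d" "y + e \<le> xc" using d y_less by (auto simp: e_def min_def field_simps)
    then show "\<exists>z>y. z \<le> xc \<and> \<nu> * (z - y) < (h z - h y) * (x + \<delta>)"
      using d(2)[of e] by (intro exI[of _ "y + e"]) (auto simp: algebra_simps)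
    have "(?f (x - \<delta>) has_real_derivative - (\<delta> * h')) (at y)"
      using deriv'[of "x - \<delta>"] h' by (simp add: algebra_simps)
    from has_real_derivative_neg_dec_left[OF this] \<delta> h' obtain d
      where d: "0 < d" "\<And>e. 0 < e \<Longrightarrow> e < d \<Longrightarrow> ?f (x - \<delta>) y < ?f (x - \<delta>) (y - e)" by auto
    define e where "e = min (d / 2) (y / 2)"
    have "0 < e" "e < d" "e < y" using d y_pos by (auto simp: e_def)
    then show "\<exists>z<y. 0 < z \<and> \<nu> * (z - y) < (h z - h y) * (x - \<delta>)"
      using d(2)[of e] by (intro exI[of _ "y - e"]) (auto simp: algebra_simps)
  qed
qed

end

section \<open>The moment generating function of the counting process\<close>

text \<open>Carries independence of two sigma-algebras over to functions measurable for them: the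
  sigma-algebras generated by \<open>f\<close> and \<open>g\<close> are contained in
  \<open>F\<close> and \<open>G\<close>, and the pair becomes a family indexed by
  \<open>bool\<close>.\<close>

lemma (in prob_space) nn_integral_mult_indep_set:
  fixes f g :: "'a \<Rightarrow> ennreal"
  assumes indep: "indep_set (sets F) (sets G)"
    and "space F = space M" "space G = space M"
    and f: "f \<in> borel_measurable F" and g: "g \<in> borel_measurable G"
  shows "(\<integral>\<^sup>+ \<omega>. f \<omega> * g \<omega> \<partial>M) = (\<integral>\<^sup>+ \<omega>. f \<omega> \<partial>M) * (\<integral>\<^sup>+ \<omega>. g \<omega> \<partial>M)"
proof -
  have sub: "sets F \<subseteq> events" "sets G \<subseteq> events"
    using indep_setD_ev1[OF indep] indep_setD_ev2[OF indep] by auto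
  have [measurable]: "f \<in> borel_measurable M" "g \<in> borel_measurable M"
    using f g sub assms(2,3) by (auto simp: measurable_def)
  have "indep_var borel f borel g"
    unfolding indep_var_eq
  proof (intro conjI)
    have "sigma_sets (space M) {f -` A \<inter> space M |A. A \<in> sets borel} \<subseteq> sets F"
      using f assms(2) by (subst assms(2)[symmetric], intro sets.sigma_sets_subset) (auto simp: measurable_def)
    moreover have "sigma_sets (space M) {g -` A \<inter> space M |A. A \<in> sets borel} \<subseteq> sets G"
      using g assms(3) by (subst assms(3)[symmetric], intro sets.sigma_sets_subset) (auto simp: measurable_def)
    ultimately show "indep_set (sigma_sets (space M) {f -` A \<inter> space M |A. A \<in> sets borel})
       (sigma_sets (space M) {g -` A \<inter> space M |A. A \<in> sets borel})"
      using indep sub unfolding indep_sets2_eq by blast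
  qed auto
  moreover have "case_bool borel borel = (\<lambda>_::bool. borel :: ennreal measure)"
    by (auto split: bool.split)
  ultimately have "indep_vars (\<lambda>_. borel) (case_bool f g) UNIV"
    by (simp add: indep_var_def)
  from indep_vars_nn_integral[OF _ this] show ?thesis
    by (simp add: UNIV_bool mult.commute)
qed

text \<open>The law of \<open>Z t\<close> is given through \<open>real_cond_exp\<close>, whereas the
  computation runs in nonnegative integrals. Both versions agree because the conditional expectation
  of an indicator is at most 1, hence finite, and the negative part vanishes.\<close>

lemma (in finite_measure_subalgebra) nn_cond_exp_indicator:
  assumes A: "A \<in> sets M"
  shows "AE \<omega> in M. nn_cond_exp M F (indicator A) \<omega> = ennreal (real_cond_exp M F (indicator A) \<omega>)"
proof -
  have "AE \<omega> in M. nn_cond_exp M F (indicator A) \<omega> \<le> nn_cond_exp M F (\<lambda>_. 1) \<omega>"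
    using A by (intro nn_cond_exp_mono) (auto split: split_indicator)
  moreover have "AE \<omega> in M. 1 = nn_cond_exp M F (\<lambda>_. 1) \<omega>" by (intro nn_cond_exp_F_meas) auto
  moreover have "AE \<omega> in M. 0 = nn_cond_exp M F (\<lambda>_. 0) \<omega>" by (intro nn_cond_exp_F_meas) auto
  ultimately show ?thesis
  proof eventually_elim
    case (elim \<omega>)
    have "(\<lambda>\<omega>. ennreal (indicator A \<omega>)) = indicator A" "(\<lambda>\<omega>. ennreal (- indicator A \<omega>)) = (\<lambda>_. 0)"
      by (auto simp: fun_eq_iff ennreal_neg split: split_indicator)
    with elim have "real_cond_exp M F (indicator A) \<omega> = enn2real (nn_cond_exp M F (indicator A) \<omega>)"
      by (simp add: real_cond_exp_def)
    moreover have "nn_cond_exp M F (indicator A) \<omega> < top"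
      using elim by (intro le_less_trans[OF _ ennreal_one_less_top]) simp
    ultimately show ?case by simp
  qed
qed

text \<open>The probability generating function at \<open>b\<close> of the Poisson law with mean
  \<open>r\<close>.\<close>

lemma suminf_poisson_mgf:
  fixes b r :: real
  assumes "0 \<le> b" "0 \<le> r"
  shows "(\<Sum>k. ennreal (b ^ k * (r ^ k / fact k * exp (- r)))) = ennreal (exp (r * (b - 1)))"
proof (rule suminf_ennreal_eq)
  have "(\<lambda>k. (b * r) ^ k /\<^sub>R fact k * exp (- r)) sums (exp (b * r) * exp (- r))"
    by (intro sums_mult2 exp_converges)
  also have "(\<lambda>k. (b * r) ^ k /\<^sub>R fact k * exp (- r)) = (\<lambda>k. b ^ k * (r ^ k / fact k * exp (- r)))"
    by (auto simp: power_mult_distrib field_simps)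
  also have "exp (b * r) * exp (- r) = exp (r * (b - 1))"
    by (simp add: mult_exp_exp algebra_simps)
  finally show "(\<lambda>k. b ^ k * (r ^ k / fact k * exp (- r))) sums exp (r * (b - 1))" .
qed (use assms in auto)

text \<open>With \<open>\<psi> c = E[exp (c l)]\<close> this is the moment generating function at \<open>\<theta>\<close> of the total number
  of points that an immigrant and its offspring produce within \<open>n\<close> time steps after its arrival.\<close>

function cluster_mgf :: "(real \<Rightarrow> real) \<Rightarrow> (nat \<Rightarrow> real) \<Rightarrow> real \<Rightarrow> nat \<Rightarrow> real" where
  "cluster_mgf \<psi> \<alpha> \<theta> n = exp \<theta> * \<psi> (\<Sum>s=1..n. \<alpha> s * (cluster_mgf \<psi> \<alpha> \<theta> (n - s) - 1))"
  by auto
termination by (relation "Wellfounded.measure (\<lambda>(_, _, _, n). n)") auto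

declare cluster_mgf.simps [simp del]

section \<open>Measurability and positivity of the process\<close>

context discrete_marked_hawkes
begin

lemma marks_measurable: "1 \<le> t \<Longrightarrow> 1 \<le> j \<Longrightarrow> l t j \<in> borel_measurable M"
  using marks_indep by (auto simp: indep_vars_def)

text \<open>A sum with a random number of terms is measurable by splitting over the countably many
  values of \<open>Z t\<close>.\<close>

lemma X_measurable [measurable]: "X t \<in> borel_measurable M"
proof (cases "t = 0")
  case True
  then show ?thesis using X_0 by (subst measurable_cong[where g="\<lambda>_. 0"]) auto
next
  case False
  then have "1 \<le> t" by simp
  have "(\<lambda>\<omega>. (\<lambda>k \<omega>. \<Sum>j=1..k. l t j \<omega>) (Z t \<omega>) \<omega>) \<in> borel_measurable M"
    using \<open>1 \<le> t\<close>
    by (intro measurable_compose_countable[where f="\<lambda>k \<omega>. \<Sum>j=1..k. l t j \<omega>" and g="Z t"]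
        Z_measurable borel_measurable_sum marks_measurable) auto
  then show ?thesis using X_eq[OF \<open>1 \<le> t\<close>]
    by (subst measurable_cong[where g="\<lambda>\<omega>. \<Sum>j=1..Z t \<omega>. l t j \<omega>"]) auto
qed

lemma X_nonneg: "AE \<omega> in M. 0 \<le> X t \<omega>"
proof (cases "t = 0")
  case True
  then show ?thesis using X_0 by (intro AE_I2) auto
next
  case False
  then have t: "1 \<le> t" by simp
  have "AE \<omega> in M. \<forall>j. 1 \<le> j \<longrightarrow> 0 < l t j \<omega>"
    unfolding AE_all_countable using marks_pos[OF t] by (intro allI AE_impI)
  with AE_space show ?thesis
    by eventually_elim (auto simp: X_eq[OF t] less_imp_le intro!: sum_nonneg)
qed

lemma space_history [simp]: "space (history M Z X t) = space M"
  by (simp add: history_def space_measure_of_conv)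

lemma history_generators:
  "(\<Union>s\<in>{1..t}. {Z s -` A \<inter> space M |A. A \<in> sets (count_space UNIV)} \<union>
                  {X s -` B \<inter> space M |B. B \<in> sets borel}) \<subseteq> sets M"
  using Z_measurable X_measurable by (fastforce intro: measurable_sets)

lemma sets_history:
  "sets (history M Z X t) = sigma_sets (space M)
     (\<Union>s\<in>{1..t}. {Z s -` A \<inter> space M |A. A \<in> sets (count_space UNIV)} \<union>
                  {X s -` B \<inter> space M |B. B \<in> sets borel})"
  unfolding history_def by (rule sets_measure_of) auto

lemma subalgebra_history: "subalgebra M (history M Z X t)"
  unfolding subalgebra_def sets_history
  by (intro conjI space_history sets.sigma_sets_subset history_generators)

lemma Z_history: "1 \<le> s \<Longrightarrow> s \<le> t \<Longrightarrow> Z s \<in> measurable (history M Z X t) (count_space UNIV)"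
  unfolding measurable_def sets_history space_history
  by (intro CollectI conjI ballI sigma_sets.Basic UN_I[of s] UnI1) auto

lemma X_history: "1 \<le> s \<Longrightarrow> s \<le> t \<Longrightarrow> X s \<in> borel_measurable (history M Z X t)"
  unfolding measurable_def sets_history space_history
  by (intro CollectI conjI ballI sigma_sets.Basic UN_I[of s] UnI2) auto

lemma intensity_history: "intensity \<nu> \<alpha> X t \<in> borel_measurable (history M Z X (t - 1))"
  unfolding intensity_def[abs_def]
  by (intro borel_measurable_add borel_measurable_const borel_measurable_sum borel_measurable_times
      X_history) auto

lemma intensity_pos: "AE \<omega> in M. 0 < intensity \<nu> \<alpha> X t \<omega>"
proof -
  have "AE \<omega> in M. \<forall>s. 0 \<le> X s \<omega>" unfolding AE_all_countable using X_nonneg by blast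
  then show ?thesis
  proof eventually_elim
    case (elim \<omega>)
    then have "0 \<le> (\<Sum>s=1..t-1. \<alpha> s * X (t - s) \<omega>)"
      using alpha_pos by (intro sum_nonneg mult_nonneg_nonneg) (auto intro: less_imp_le)
    then show ?case using nu_pos by (simp add: intensity_def)
  qed
qed

lemma space_history_with_count [simp]: "space (history_with_count M Z X t) = space M"
  by (simp add: history_with_count_def space_measure_of_conv)

lemma sets_history_with_count:
  "sets (history_with_count M Z X t) = sigma_sets (space M)
     (sets (history M Z X (t - 1)) \<union> {Z t -` A \<inter> space M |A. A \<in> sets (count_space UNIV)})"
  unfolding history_with_count_def
  by (rule sets_measure_of) (use sets.sets_into_space[of _ "history M Z X (t - 1)"] in auto)

lemma history_le_history_with_count:
  "f \<in> measurable (history M Z X (t - 1)) N \<Longrightarrow> f \<in> measurable (history_with_count M Z X t) N"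
  by (auto simp: measurable_def sets_history_with_count)

lemma Z_history_with_count: "Z t \<in> measurable (history_with_count M Z X t) (count_space UNIV)"
  by (rule measurableI) (auto simp: sets_history_with_count)

lemma space_marks_algebra [simp]: "space (marks_algebra M l t) = space M"
  by (simp add: marks_algebra_def space_measure_of_conv)

lemma marks_marks_algebra: "1 \<le> j \<Longrightarrow> l t j \<in> borel_measurable (marks_algebra M l t)"
proof (rule measurableI)
  fix B :: "real set" assume "1 \<le> j" "B \<in> sets borel"
  moreover have "sets (marks_algebra M l t)
      = sigma_sets (space M) (\<Union>j\<in>{1..}. {l t j -` B \<inter> space M |B. B \<in> sets borel})"
    unfolding marks_algebra_def by (rule sets_measure_of) auto
  ultimately show "l t j -` B \<inter> space (marks_algebra M l t) \<in> sets (marks_algebra M l t)"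
    by (auto intro!: sigma_sets.Basic)
qed auto

section \<open>Integrating out time steps\<close>

lemma nn_integral_exp_sum_marks:
  assumes t: "1 \<le> t" and int: "integrable M (\<lambda>\<omega>. exp (c * l 1 1 \<omega>))"
  shows "(\<integral>\<^sup>+ \<omega>. ennreal (exp (c * (\<Sum>j=1..k. l t j \<omega>))) \<partial>M)
    = ennreal (expectation (\<lambda>\<omega>. exp (c * l 1 1 \<omega>)) ^ k)"
proof -
  let ?K = "expectation (\<lambda>\<omega>. exp (c * l 1 1 \<omega>))"
  have one: "(\<integral>\<^sup>+ \<omega>. ennreal (exp (c * l t j \<omega>)) \<partial>M) = ennreal ?K" if j: "1 \<le> j" for j
  proof -
    have "(\<integral>\<^sup>+ \<omega>. ennreal (exp (c * l t j \<omega>)) \<partial>M) = (\<integral>\<^sup>+ x. ennreal (exp (c * x)) \<partial>distr M borel (l t j))"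
      using marks_measurable[OF t j] by (subst nn_integral_distr) auto
    also have "\<dots> = (\<integral>\<^sup>+ \<omega>. ennreal (exp (c * l 1 1 \<omega>)) \<partial>M)"
      using marks_measurable[of 1 1] by (subst marks_distr[OF t j], subst nn_integral_distr) auto
    also have "\<dots> = ennreal ?K" by (rule nn_integral_eq_integral[OF int]) simp
    finally show ?thesis .
  qed
  let ?J = "Pair t ` {1..k}"
  have "indep_vars (\<lambda>_. borel) (\<lambda>(t, j). l t j) ?J"
    using t by (intro indep_vars_subset[OF marks_indep]) auto
  then have "indep_vars (\<lambda>_. borel) (\<lambda>i \<omega>. ennreal (exp (c * (case i of (t, j) \<Rightarrow> l t j) \<omega>))) ?J"
    by (rule indep_vars_compose2) measurable
  then have "(\<integral>\<^sup>+ \<omega>. (\<Prod>i\<in>?J. ennreal (exp (c * (case i of (t, j) \<Rightarrow> l t j) \<omega>))) \<partial>M)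
      = (\<Prod>i\<in>?J. \<integral>\<^sup>+ \<omega>. ennreal (exp (c * (case i of (t, j) \<Rightarrow> l t j) \<omega>)) \<partial>M)"
    by (intro indep_vars_nn_integral) auto
  also have "\<dots> = (\<Prod>j=1..k. ennreal ?K)"
    by (subst prod.reindex) (auto simp: inj_on_def one intro!: prod.cong)
  also have "\<dots> = ennreal (?K ^ k)" by (simp add: ennreal_power)
  finally show ?thesis
    by (subst (asm) prod.reindex) (auto simp: inj_on_def prod_ennreal exp_sum sum_distrib_left)
qed

text \<open>Conditioning on the past at time \<open>t\<close>. On \<open>Z t = k\<close> the marks,
  independent of past and count jointly, contribute the \<open>k\<close>-th power of their moment
  generating function; summing these powers against the conditional Poisson weights gives the
  exponential on the right. All terms are nonnegative, so sums and integrals commute.\<close>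

lemma nn_integral_step:
  assumes t: "1 \<le> t" and int: "integrable M (\<lambda>\<omega>. exp (c * l 1 1 \<omega>))"
    and Y: "Y \<in> borel_measurable (history M Z X (t - 1))"
  shows "(\<integral>\<^sup>+ \<omega>. Y \<omega> * ennreal (exp (\<theta> * real (Z t \<omega>) + c * X t \<omega>)) \<partial>M)
    = (\<integral>\<^sup>+ \<omega>. Y \<omega> * ennreal (exp (intensity \<nu> \<alpha> X t \<omega> *
        (exp \<theta> * expectation (\<lambda>\<omega>. exp (c * l 1 1 \<omega>)) - 1))) \<partial>M)"
proof -
  interpret H: finite_measure_subalgebra M "history M Z X (t - 1)"
    by (intro finite_measure_subalgebra.intro finite_measure_axioms
        finite_measure_subalgebra_axioms.intro subalgebra_history)
  let ?K = "expectation (\<lambda>\<omega>. exp (c * l 1 1 \<omega>))"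
  let ?I = "\<lambda>k. indicator {\<omega> \<in> space M. Z t \<omega> = k} :: 'a \<Rightarrow> ennreal"
  note [measurable] = Z_measurable[OF t] measurable_from_subalg[OF subalgebra_history Y]
    measurable_from_subalg[OF subalgebra_history intensity_history[of t]]
  have [measurable]: "l t j \<in> borel_measurable M" if "j \<in> {1..k}" for j k
    using that t by (intro marks_measurable) auto
  have K: "0 \<le> ?K" by (intro integral_nonneg_AE) auto
  have event [measurable]: "{\<omega> \<in> space M. Z t \<omega> = k} \<in> events" for k by measurable
  have [measurable]: "?I k \<in> borel_measurable M" for k by (rule borel_measurable_indicator[OF event])
  have Y_M: "Y \<in> borel_measurable M" by (rule measurable_from_subalg[OF subalgebra_history Y])
  have YI: "(\<lambda>\<omega>. Y \<omega> * ?I k \<omega>) \<in> borel_measurable M" for k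
    by (intro borel_measurable_times_ennreal Y_M borel_measurable_indicator event)
  have marks_M: "(\<lambda>\<omega>. ennreal (exp (c * (\<Sum>j=1..k. l t j \<omega>)))) \<in> borel_measurable M" for k
    by measurable
  have pmf_M: "(\<lambda>\<omega>. ennreal (b * (intensity \<nu> \<alpha> X t \<omega> ^ k / fact k * exp (- intensity \<nu> \<alpha> X t \<omega>))))
      \<in> borel_measurable M" for b k
    by measurable
  have "(\<integral>\<^sup>+ \<omega>. Y \<omega> * ennreal (exp (\<theta> * real (Z t \<omega>) + c * X t \<omega>)) \<partial>M)
      = (\<integral>\<^sup>+ \<omega>. (\<Sum>k. ennreal (exp \<theta> ^ k) * (ennreal (exp (c * (\<Sum>j=1..k. l t j \<omega>))) * (Y \<omega> * ?I k \<omega>))) \<partial>M)"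
  proof (rule nn_integral_cong)
    fix \<omega> assume "\<omega> \<in> space M"
    let ?f = "\<lambda>k. ennreal (exp \<theta> ^ k) * (ennreal (exp (c * (\<Sum>j=1..k. l t j \<omega>))) * (Y \<omega> * ?I k \<omega>))"
    have "(\<Sum>k. ?f k) = (\<Sum>k\<in>{Z t \<omega>}. ?f k)" by (rule suminf_finite) (auto simp: indicator_def)
    also have "\<dots> = Y \<omega> * ennreal (exp (\<theta> * real (Z t \<omega>) + c * X t \<omega>))"
      using \<open>\<omega> \<in> space M\<close> t
      by (simp add: X_eq exp_add ennreal_mult exp_of_nat_mult[symmetric] mult_ac)
    finally show "Y \<omega> * ennreal (exp (\<theta> * real (Z t \<omega>) + c * X t \<omega>)) = (\<Sum>k. ?f k)" ..
  qed
  also have "\<dots> = (\<Sum>k. \<integral>\<^sup>+ \<omega>. ennreal (exp \<theta> ^ k) * (ennreal (exp (c * (\<Sum>j=1..k. l t j \<omega>))) * (Y \<omega> * ?I k \<omega>)) \<partial>M)"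
    by (intro nn_integral_suminf borel_measurable_times_ennreal measurable_const marks_M YI) auto
  also have "\<dots> = (\<Sum>k. \<integral>\<^sup>+ \<omega>. Y \<omega> * ennreal ((exp \<theta> * ?K) ^ k *
      (intensity \<nu> \<alpha> X t \<omega> ^ k / fact k * exp (- intensity \<nu> \<alpha> X t \<omega>))) \<partial>M)"
  proof (rule suminf_cong)
    fix k
    have "(\<integral>\<^sup>+ \<omega>. ennreal (exp \<theta> ^ k) * (ennreal (exp (c * (\<Sum>j=1..k. l t j \<omega>))) * (Y \<omega> * ?I k \<omega>)) \<partial>M)
        = ennreal (exp \<theta> ^ k) * (\<integral>\<^sup>+ \<omega>. ennreal (exp (c * (\<Sum>j=1..k. l t j \<omega>))) * (Y \<omega> * ?I k \<omega>) \<partial>M)"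
      by (intro nn_integral_cmult borel_measurable_times_ennreal marks_M YI)
    also have "(\<integral>\<^sup>+ \<omega>. ennreal (exp (c * (\<Sum>j=1..k. l t j \<omega>))) * (Y \<omega> * ?I k \<omega>) \<partial>M)
        = (\<integral>\<^sup>+ \<omega>. ennreal (exp (c * (\<Sum>j=1..k. l t j \<omega>))) \<partial>M) * (\<integral>\<^sup>+ \<omega>. Y \<omega> * ?I k \<omega> \<partial>M)"
    proof (rule nn_integral_mult_indep_set[OF marks_indep_past[OF t]])
      show "(\<lambda>\<omega>. ennreal (exp (c * (\<Sum>j=1..k. l t j \<omega>)))) \<in> borel_measurable (marks_algebra M l t)"
        by (intro measurable_compose[OF _ measurable_ennreal] measurable_compose[OF _ borel_measurable_exp]
            borel_measurable_times borel_measurable_const borel_measurable_sum marks_marks_algebra) auto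
      have "{\<omega> \<in> space M. Z t \<omega> = k} \<in> sets (history_with_count M Z X t)"
        using measurable_sets[OF Z_history_with_count[of t], of "{k}"]
        by (simp add: vimage_def Int_def conj_commute)
      then show "(\<lambda>\<omega>. Y \<omega> * ?I k \<omega>) \<in> borel_measurable (history_with_count M Z X t)"
        by (intro borel_measurable_times_ennreal history_le_history_with_count Y borel_measurable_indicator)
    qed auto
    \<comment> \<open>\<open>Y\<close> depends on the past only, so the indicator may be replaced by
      its conditional expectation, which is the Poisson weight.\<close>
    also have "(\<integral>\<^sup>+ \<omega>. Y \<omega> * ?I k \<omega> \<partial>M)
        = (\<integral>\<^sup>+ \<omega>. Y \<omega> * nn_cond_exp M (history M Z X (t - 1)) (?I k) \<omega> \<partial>M)"
      by (rule H.nn_cond_exp_intg[symmetric, OF Y]) measurable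
    also have "\<dots> = (\<integral>\<^sup>+ \<omega>. Y \<omega> * ennreal (intensity \<nu> \<alpha> X t \<omega> ^ k / fact k * exp (- intensity \<nu> \<alpha> X t \<omega>)) \<partial>M)"
      using H.nn_cond_exp_indicator[OF event[of k]] Z_cond_Poisson[OF t, of k] intensity_pos[of t]
      by (intro nn_integral_cong_AE, eventually_elim) simp
    also have "ennreal (exp \<theta> ^ k) * ((\<integral>\<^sup>+ \<omega>. ennreal (exp (c * (\<Sum>j=1..k. l t j \<omega>))) \<partial>M) * \<dots>)
        = ennreal ((exp \<theta> * ?K) ^ k) * \<dots>"
      using K unfolding nn_integral_exp_sum_marks[OF t int]
      by (simp add: power_mult_distrib ennreal_mult mult.assoc)
    also have "\<dots> = (\<integral>\<^sup>+ \<omega>. ennreal ((exp \<theta> * ?K) ^ k) *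
        (Y \<omega> * ennreal (intensity \<nu> \<alpha> X t \<omega> ^ k / fact k * exp (- intensity \<nu> \<alpha> X t \<omega>))) \<partial>M)"
      using pmf_M[of 1] by (intro nn_integral_cmult[symmetric] borel_measurable_times_ennreal Y_M) simp
    also have "\<dots> = (\<integral>\<^sup>+ \<omega>. Y \<omega> * ennreal ((exp \<theta> * ?K) ^ k *
      (intensity \<nu> \<alpha> X t \<omega> ^ k / fact k * exp (- intensity \<nu> \<alpha> X t \<omega>))) \<partial>M)"
      unfolding ennreal_mult'[OF zero_le_power[OF mult_nonneg_nonneg[OF exp_ge_zero K]]]
      by (intro nn_integral_cong mult.left_commute)
    finally show "(\<integral>\<^sup>+ \<omega>. ennreal (exp \<theta> ^ k) * (ennreal (exp (c * (\<Sum>j=1..k. l t j \<omega>))) * (Y \<omega> * ?I k \<omega>)) \<partial>M)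
        = (\<integral>\<^sup>+ \<omega>. Y \<omega> * ennreal ((exp \<theta> * ?K) ^ k *
      (intensity \<nu> \<alpha> X t \<omega> ^ k / fact k * exp (- intensity \<nu> \<alpha> X t \<omega>))) \<partial>M)" .
  qed
  also have "\<dots> = (\<integral>\<^sup>+ \<omega>. (\<Sum>k. Y \<omega> * ennreal ((exp \<theta> * ?K) ^ k *
      (intensity \<nu> \<alpha> X t \<omega> ^ k / fact k * exp (- intensity \<nu> \<alpha> X t \<omega>)))) \<partial>M)"
    by (intro nn_integral_suminf[symmetric] borel_measurable_times_ennreal Y_M pmf_M)
  also have "\<dots> = (\<integral>\<^sup>+ \<omega>. Y \<omega> * ennreal (exp (intensity \<nu> \<alpha> X t \<omega> * (exp \<theta> * ?K - 1))) \<partial>M)"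
    using intensity_pos[of t]
    by (intro nn_integral_cong_AE, eventually_elim)
      (simp only: ennreal_suminf_cmult suminf_poisson_mgf less_imp_le mult_nonneg_nonneg[OF exp_ge_zero K])
  finally show ?thesis .
qed

text \<open>The steps \<open>t, t - 1, ..., 1\<close> are integrated out in turn. Each replaces the
  contribution of \<open>Z n\<close> and \<open>X n\<close> by an exponential that is linear in the
  earlier \<open>X u\<close>, so the form of the integrand is preserved.\<close>

lemma nn_integral_exp_counting_process:
  fixes \<theta> :: real and t :: nat
  defines "G \<equiv> cluster_mgf (\<lambda>c. expectation (\<lambda>\<omega>. exp (c * l 1 1 \<omega>))) \<alpha> \<theta>"
  assumes int: "\<And>n. integrable M (\<lambda>\<omega>. exp ((\<Sum>s=1..n. \<alpha> s * (G (n - s) - 1)) * l 1 1 \<omega>))"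
  shows "(\<integral>\<^sup>+ \<omega>. ennreal (exp (\<theta> * real (counting_process Z t \<omega>))) \<partial>M)
    = ennreal (exp (\<nu> * (\<Sum>k<t. G k - 1)))"
proof -
  \<comment> \<open>The exponent accumulated after \<open>r\<close> steps. Summand \<open>k\<close>
    is \<open>G k - 1\<close> times the part of the intensity at time \<open>t - k\<close> that
    involves only \<open>X 1, ..., X n\<close>.\<close>
  define E where "E = (\<lambda>r n \<omega>. \<Sum>k<r. (G k - 1) * (\<nu> + (\<Sum>u=1..n. \<alpha> (t - k - u) * X u \<omega>)))"
  have "(\<integral>\<^sup>+ \<omega>. ennreal (exp (\<theta> * real (counting_process Z t \<omega>))) \<partial>M)
    = (\<integral>\<^sup>+ \<omega>. ennreal (exp (\<theta> * real (counting_process Z (t - r) \<omega>) + E r (t - r) \<omega>)) \<partial>M)"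
    if "r \<le> t" for r
    using that
  proof (induction r)
    case 0
    then show ?case by (simp add: E_def)
  next
    case (Suc r)
    define n where "n = t - r"
    have n: "1 \<le> n" "t - Suc r = n - 1" "r + n = t" using Suc.prems by (auto simp: n_def)
    define c where "c = (\<Sum>s=1..r. \<alpha> s * (G (r - s) - 1))"
    define Y where "Y = (\<lambda>\<omega>. \<theta> * real (counting_process Z (n - 1) \<omega>) + E r (n - 1) \<omega>)"
    have Y_meas: "Y \<in> borel_measurable (history M Z X (n - 1))"
    proof -
      have "(\<lambda>\<omega>. \<theta> * (\<Sum>s=1..n - 1. real (Z s \<omega>))) \<in> borel_measurable (history M Z X (n - 1))"
        by (intro borel_measurable_times borel_measurable_const borel_measurable_sum
            measurable_compose[OF Z_history]) auto
      moreover have "E r (n - 1) \<in> borel_measurable (history M Z X (n - 1))"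
        unfolding E_def
        by (intro borel_measurable_times borel_measurable_add borel_measurable_const
            borel_measurable_sum X_history) auto
      ultimately show ?thesis unfolding Y_def counting_process_def of_nat_sum
        by (rule borel_measurable_add)
    qed
    have last: "{1..n} = insert n {1..n - 1}" using n(1) by auto
    \<comment> \<open>As \<open>r + n = t\<close>, the substitution \<open>s = r - k\<close>
      identifies the total coefficient of \<open>X n\<close> in \<open>E r n\<close> with the
      argument of \<psi> in the recursion for \<open>G r\<close>.\<close>
    have c: "c = (\<Sum>k<r. (G k - 1) * \<alpha> (t - k - n))"
      unfolding c_def using n(3)
      by (intro sum.reindex_bij_witness[of _ "\<lambda>k. r - k" "\<lambda>s. r - s"]) (auto simp: mult.commute)
    have split: "\<theta> * real (counting_process Z n \<omega>) + E r n \<omega>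
        = Y \<omega> + (\<theta> * real (Z n \<omega>) + c * X n \<omega>)" for \<omega>
    proof -
      have "E r n \<omega> = E r (n - 1) \<omega> + c * X n \<omega>"
        using n(1) unfolding E_def c last
        by (simp add: distrib_left sum.distrib sum_distrib_left ac_simps)
      then show ?thesis
        using n(1) unfolding Y_def counting_process_def last by (simp add: distrib_left)
    qed
    have "intensity \<nu> \<alpha> X n \<omega> = \<nu> + (\<Sum>u=1..n - 1. \<alpha> (t - r - u) * X u \<omega>)" for \<omega>
      unfolding intensity_def n_def[symmetric]
      by (intro arg_cong2[where f="(+)"] refl sum.reindex_bij_witness[of _ "\<lambda>u. n - u" "\<lambda>s. n - s"]) auto
    \<comment> \<open>The exponent created by this step is exactly the new summand
      \<open>k = r\<close> of \<open>E\<close>.\<close>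
    then have join: "Y \<omega> + intensity \<nu> \<alpha> X n \<omega> * (G r - 1)
        = \<theta> * real (counting_process Z (n - 1) \<omega>) + E (Suc r) (n - 1) \<omega>" for \<omega>
      by (simp add: Y_def E_def)
    have "(\<integral>\<^sup>+ \<omega>. ennreal (exp (\<theta> * real (counting_process Z t \<omega>))) \<partial>M)
        = (\<integral>\<^sup>+ \<omega>. ennreal (exp (Y \<omega>)) * ennreal (exp (\<theta> * real (Z n \<omega>) + c * X n \<omega>)) \<partial>M)"
      using Suc unfolding n_def[symmetric] split by (simp add: exp_add ennreal_mult)
    also have "\<dots> = (\<integral>\<^sup>+ \<omega>. ennreal (exp (Y \<omega>)) * ennreal (exp (intensity \<nu> \<alpha> X n \<omega> *
        (exp \<theta> * expectation (\<lambda>\<omega>. exp (c * l 1 1 \<omega>)) - 1))) \<partial>M)"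
      using Y_meas int[of r] unfolding c_def[symmetric] by (intro nn_integral_step n) auto
    also have "exp \<theta> * expectation (\<lambda>\<omega>. exp (c * l 1 1 \<omega>)) = G r"
      unfolding c_def G_def by (subst (2) cluster_mgf.simps) simp
    finally show ?case
      unfolding n(2) join[symmetric] by (simp add: exp_add ennreal_mult)
  qed
  \<comment> \<open>After \<open>t\<close> steps no time is left: the counting process at 0 vanishes
    and \<open>E t 0\<close> is deterministic.\<close>
  from this[of t] show ?thesis
    by (simp add: E_def counting_process_def emeasure_space_1 sum_distrib_left mult.commute)
qed

end

section \<open>The limiting cumulant generating function\<close>

lemma cesaro_mean_tendsto:
  fixes f :: "nat \<Rightarrow> real"
  assumes "f \<longlonglongrightarrow> L"
  shows "(\<lambda>n. (\<Sum>k<n. f k) / real n) \<longlonglongrightarrow> L"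
proof (rule LIMSEQ_I)
  fix r :: real assume r: "0 < r"
  obtain N where N: "\<And>n. N \<le> n \<Longrightarrow> \<bar>f n - L\<bar> < r / 2"
    using LIMSEQ_D[OF assms, of "r / 2"] r by auto
  define C where "C = (\<Sum>k<N. \<bar>f k - L\<bar>)"
  have "eventually (\<lambda>n. C / real n < r / 2) sequentially"
    using r by (intro order_tendstoD(2)[OF lim_const_over_n]) auto
  then have "eventually (\<lambda>n. N < n \<and> C / real n < r / 2) sequentially"
    using eventually_gt_at_top[of N] by eventually_elim simp
  then obtain K where K: "\<And>n. K \<le> n \<Longrightarrow> N < n \<and> C / real n < r / 2"
    by (auto simp: eventually_sequentially)
  show "\<exists>K. \<forall>n\<ge>K. norm ((\<Sum>k<n. f k) / real n - L) < r"
  proof (intro exI allI impI)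
    fix n assume "K \<le> n"
    with K have n: "N < n" "C / real n < r / 2" by auto
    have "(\<Sum>k<n. f k) / real n - L = (\<Sum>k<n. f k - L) / real n"
      using n by (simp add: sum_subtractf field_simps)
    also have "\<bar>\<dots>\<bar> \<le> (\<Sum>k<n. \<bar>f k - L\<bar>) / real n"
      by (simp add: divide_right_mono)
    also have "(\<Sum>k<n. \<bar>f k - L\<bar>) = C + (\<Sum>k=N..<n. \<bar>f k - L\<bar>)"
      using n unfolding C_def
      by (subst sum.union_disjoint[symmetric]) (auto intro!: sum.cong)
    also have "(\<Sum>k=N..<n. \<bar>f k - L\<bar>) \<le> (\<Sum>k=N..<n. r / 2)"
      using N by (intro sum_mono) (auto intro: less_imp_le)
    also have "\<dots> \<le> real n * (r / 2)" using r by simp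
    finally have "\<bar>(\<Sum>k<n. f k) / real n - L\<bar> \<le> C / real n + r / 2"
      using n by (simp add: add_divide_distrib divide_right_mono)
    with n(2) show "norm ((\<Sum>k<n. f k) / real n - L) < r" unfolding real_norm_def by linarith
  qed
qed

text \<open>Tannery's theorem: extended by 0 beyond \<open>n\<close>, the summands converge for
  fixed \<open>k\<close> and are dominated by \<open>\<bar>\<alpha> (Suc k)\<bar>\<close> times a
  bound of \<open>f\<close>.\<close>

lemma convolution_tendsto:
  fixes \<alpha> f :: "nat \<Rightarrow> real"
  assumes sm: "summable (\<lambda>t. \<bar>\<alpha> (Suc t)\<bar>)" and f: "f \<longlonglongrightarrow> L"
  shows "(\<lambda>n. \<Sum>s=1..n. \<alpha> s * f (n - s)) \<longlonglongrightarrow> norm1 \<alpha> * L"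
proof -
  obtain B where B: "\<And>n. norm (f n) \<le> B"
    using convergent_imp_Bseq[OF convergentI[OF f]] by (auto simp: Bseq_def)
  define b where "b = (\<lambda>k n. if k < n then \<alpha> (Suc k) * f (n - Suc k) else 0)"
  have "(\<lambda>n. \<Sum>k. b k n) \<longlonglongrightarrow> (\<Sum>k. \<alpha> (Suc k) * L)"
  proof (rule tannerys_theorem[THEN conjunct2, THEN conjunct2])
    show "(\<lambda>n. b k n) \<longlonglongrightarrow> \<alpha> (Suc k) * L" for k
    proof (rule Lim_transform_eventually)
      have "filterlim (\<lambda>n. n - Suc k) sequentially sequentially" by (rule filterlim_minus_const_nat_at_top)
      then show "(\<lambda>n. \<alpha> (Suc k) * f (n - Suc k)) \<longlonglongrightarrow> \<alpha> (Suc k) * L"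
        by (intro tendsto_intros filterlim_compose[OF f])
      show "eventually (\<lambda>n. \<alpha> (Suc k) * f (n - Suc k) = b k n) sequentially"
        using eventually_gt_at_top[of k] by eventually_elim (simp add: b_def)
    qed
    have "0 \<le> B" using B[of 0] norm_ge_zero order_trans by blast
    then show "eventually (\<lambda>(k, n). norm (b k n) \<le> \<bar>\<alpha> (Suc k)\<bar> * B) (sequentially \<times>\<^sub>F sequentially)"
      using B by (intro always_eventually) (auto simp: b_def abs_mult intro!: mult_left_mono)
    show "summable (\<lambda>k. \<bar>\<alpha> (Suc k)\<bar> * B)" by (rule summable_mult2[OF sm])
  qed simp
  also have "(\<Sum>k. \<alpha> (Suc k) * L) = norm1 \<alpha> * L"
    unfolding norm1_def by (rule suminf_mult2[symmetric, OF summable_rabs_cancel[OF sm]])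
  also have "(\<lambda>n. \<Sum>k. b k n) = (\<lambda>n. \<Sum>s=1..n. \<alpha> s * f (n - s))"
  proof
    fix n
    have "(\<Sum>k. b k n) = (\<Sum>k<n. b k n)" by (rule suminf_finite) (auto simp: b_def)
    also have "\<dots> = (\<Sum>s=1..n. \<alpha> s * f (n - s))"
      by (rule sum.reindex_bij_witness[of _ "\<lambda>s. s - 1" Suc]) (auto simp: b_def)
    finally show "(\<Sum>k. b k n) = (\<Sum>s=1..n. \<alpha> s * f (n - s))" .
  qed
  finally show ?thesis .
qed

section \<open>The process together with a critical point\<close>

locale critical_hawkes = discrete_marked_hawkes M \<nu> \<alpha> l Z X
  for M :: "'a measure" and \<nu> \<alpha> l Z X +
  fixes m :: "'a \<Rightarrow> real" and xc :: real
  assumes mark_eq: "l 1 1 = m"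
    and alpha_summable: "summable (\<lambda>t. \<alpha> (Suc t))"
    and xc_gt_1': "1 < xc"
    and critical': "critical_equation M (norm1 \<alpha>) m xc"
begin

lemma norm1_pos: "0 < norm1 \<alpha>"
  unfolding norm1_def using alpha_pos by (intro suminf_pos alpha_summable) auto

sublocale critical_mark M "norm1 \<alpha>" m xc
  using marks_measurable[of 1 1] norm1_pos marks_pos[of 1 1] xc_gt_1' critical'
  unfolding mark_eq by unfold_locales auto

definition \<psi> :: "real \<Rightarrow> real" where
  "\<psi> c = expectation (\<lambda>\<omega>. exp (c * m \<omega>))"

abbreviation gen :: "real \<Rightarrow> real" where
  "gen \<equiv> g M (norm1 \<alpha>) m"

lemma \<phi>_conv_\<psi>: "\<phi> y = \<psi> (norm1 \<alpha> * (y - 1))"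
  by (simp add: \<phi>_def \<psi>_def mult_ac)

lemma \<psi>_conv_\<phi>: "\<psi> c = \<phi> (1 + c / norm1 \<alpha>)"
  using norm1_pos by (simp add: \<phi>_conv_\<psi>)

lemma integrable_exp_mult_mark:
  assumes "c \<le> norm1 \<alpha> * (xc - 1)"
  shows "integrable M (\<lambda>\<omega>. exp (c * m \<omega>))"
proof -
  have "1 + c / norm1 \<alpha> \<le> xc" using assms norm1_pos by (simp add: field_simps)
  from integrable_exp_mark[OF this] show ?thesis using norm1_pos by (simp add: field_simps)
qed

lemma \<psi>_mono: "c \<le> d \<Longrightarrow> d \<le> norm1 \<alpha> * (xc - 1) \<Longrightarrow> \<psi> c \<le> \<psi> d"
  unfolding \<psi>_conv_\<phi> using norm1_pos by (intro \<phi>_mono) (auto simp: field_simps)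

lemma \<psi>_0: "\<psi> 0 = 1"
  by (simp add: \<psi>_conv_\<phi> \<phi>_1)

lemma gen_eq: "\<theta> \<le> h xc \<Longrightarrow> gen \<theta> = exp \<theta> * \<psi> (norm1 \<alpha> * (gen \<theta> - 1))"
  using minimal_solution_g[of \<theta>] by (simp add: minimal_solution_def g_equation_iff \<phi>_conv_\<psi>)

lemma gen_0: "gen 0 = 1"
  using g_h[of 1] xc_gt_1 by (simp add: h_1)

lemma gen_mono:
  assumes "\<theta> \<le> \<eta>" "\<eta> \<le> h xc"
  shows "gen \<theta> \<le> gen \<eta>"
proof (rule ccontr)
  assume "\<not> gen \<theta> \<le> gen \<eta>"
  then have "h (gen \<eta>) < h (gen \<theta>)" using assms by (intro h_strict_mono g_solution) auto
  with assms show False by (simp add: g_solution)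
qed

lemma sum_alpha_le: "(\<Sum>s=1..n. \<alpha> s) \<le> norm1 \<alpha>"
proof -
  have "(\<Sum>s=1..n. \<alpha> s) = (\<Sum>k<n. \<alpha> (Suc k))"
    by (rule sum.reindex_bij_witness[of _ Suc "\<lambda>s. s - 1"]) auto
  also have "\<dots> \<le> norm1 \<alpha>"
    unfolding norm1_def using alpha_pos by (intro sum_le_suminf alpha_summable) (auto intro: less_imp_le)
  finally show ?thesis .
qed

section \<open>Convergence of the cluster recursion to \<open>g\<close>\<close>

context
  fixes \<theta> :: real
  assumes \<theta>_le: "\<theta> \<le> h xc"
begin

abbreviation G :: "nat \<Rightarrow> real" where
  "G \<equiv> cluster_mgf \<psi> \<alpha> \<theta>"

abbreviation \<kappa> :: "nat \<Rightarrow> real" where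
  "\<kappa> n \<equiv> (\<Sum>s=1..n. \<alpha> s * (G (n - s) - 1))"

lemma G_eq: "G n = exp \<theta> * \<psi> (\<kappa> n)"
  by (rule cluster_mgf.simps)

text \<open>The sign \<open>\<sigma>\<close> of \<open>\<theta>\<close> lets one argument cover the increasing (\<open>\<theta> \<ge> 0\<close>) and the decreasing
  (\<open>\<theta> \<le> 0\<close>) case.\<close>

context
  fixes \<sigma> :: real
  assumes sign: "\<sigma> = 1 \<and> 0 \<le> \<theta> \<or> \<sigma> = - 1 \<and> \<theta> \<le> 0"
begin

lemma signed_gen_ge: "0 \<le> \<sigma> * (gen \<theta> - 1)"
  using sign gen_mono[of 0 \<theta>] gen_mono[of \<theta> 0] \<theta>_le gen_0 h_xc \<theta>\<^sub>c_pos by auto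

lemma signed_\<psi>_mono:
  assumes "\<sigma> * c1 \<le> \<sigma> * c2" "c1 \<le> norm1 \<alpha> * (xc - 1)" "c2 \<le> norm1 \<alpha> * (xc - 1)"
  shows "\<sigma> * (exp \<theta> * \<psi> c1) \<le> \<sigma> * (exp \<theta> * \<psi> c2)"
  using sign \<psi>_mono[of c1 c2] \<psi>_mono[of c2 c1] assms by auto

text \<open>Keeps the arguments of \<psi> in the range of integrability: for \<theta> \<ge> 0
  because \<open>gen \<theta> \<le> xc\<close>, for \<theta> \<le> 0 because
  \<open>d \<le> 0\<close>.\<close>

lemma signed_le_bound:
  assumes "0 \<le> \<sigma> * d" "\<sigma> * d \<le> \<sigma> * (norm1 \<alpha> * (gen \<theta> - 1))"
  shows "d \<le> norm1 \<alpha> * (xc - 1)"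
proof -
  have "norm1 \<alpha> * (gen \<theta> - 1) \<le> norm1 \<alpha> * (xc - 1)" "0 \<le> norm1 \<alpha> * (xc - 1)"
    using norm1_pos g_solution(2)[OF \<theta>_le] xc_gt_1 by auto
  with sign assms show ?thesis by auto
qed

lemma signed_\<kappa>_bounds:
  assumes "\<And>k. k < n \<Longrightarrow> 0 \<le> \<sigma> * (G k - 1) \<and> \<sigma> * (G k - 1) \<le> \<sigma> * (gen \<theta> - 1)"
  shows "0 \<le> \<sigma> * \<kappa> n" "\<sigma> * \<kappa> n \<le> \<sigma> * (norm1 \<alpha> * (gen \<theta> - 1))"
proof -
  have eq: "\<sigma> * \<kappa> n = (\<Sum>s=1..n. \<alpha> s * (\<sigma> * (G (n - s) - 1)))"
    by (simp add: sum_distrib_left mult.left_commute)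
  have nonneg: "0 \<le> \<alpha> s" if "s \<in> {1..n}" for s using alpha_pos[of s] that by simp
  have G: "0 \<le> \<sigma> * (G (n - s) - 1)" "\<sigma> * (G (n - s) - 1) \<le> \<sigma> * (gen \<theta> - 1)"
    if "s \<in> {1..n}" for s
    using assms[of "n - s"] that by auto
  show "0 \<le> \<sigma> * \<kappa> n" unfolding eq
    by (rule sum_nonneg) (rule mult_nonneg_nonneg[OF nonneg G(1)])
  have "\<sigma> * \<kappa> n \<le> (\<Sum>s=1..n. \<alpha> s * (\<sigma> * (gen \<theta> - 1)))" unfolding eq
    by (rule sum_mono) (rule mult_left_mono[OF G(2) nonneg])
  also have "\<dots> \<le> norm1 \<alpha> * (\<sigma> * (gen \<theta> - 1))"
    unfolding sum_distrib_right[symmetric] by (intro mult_right_mono sum_alpha_le signed_gen_ge)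
  finally show "\<sigma> * \<kappa> n \<le> \<sigma> * (norm1 \<alpha> * (gen \<theta> - 1))" by (simp add: mult.left_commute)
qed

text \<open>The earlier bounds place \<open>\<kappa> n\<close> between 0 and
  \<open>norm1 \<alpha> * (gen \<theta> - 1)\<close>. The monotone map
  \<open>c \<mapsto> exp \<theta> * \<psi> c\<close> sends these ends to
  \<open>exp \<theta>\<close>, on the correct side of 1, and to \<open>gen \<theta>\<close>, by its
  fixed-point equation.\<close>

lemma signed_G_bounds: "0 \<le> \<sigma> * (G n - 1) \<and> \<sigma> * (G n - 1) \<le> \<sigma> * (gen \<theta> - 1)"
proof (induction n rule: less_induct)
  case (less n)
  have b: "0 \<le> \<sigma> * \<kappa> n" "\<sigma> * \<kappa> n \<le> \<sigma> * (norm1 \<alpha> * (gen \<theta> - 1))"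
    using signed_\<kappa>_bounds[of n] less by blast+
  have nb: "0 \<le> \<sigma> * (norm1 \<alpha> * (gen \<theta> - 1))" by (rule order_trans[OF b])
  have bound: "\<kappa> n \<le> norm1 \<alpha> * (xc - 1)" by (rule signed_le_bound[OF b])
  have "0 \<le> norm1 \<alpha> * (xc - 1)" using norm1_pos xc_gt_1 by simp
  then have "\<sigma> * (exp \<theta> * \<psi> 0) \<le> \<sigma> * (exp \<theta> * \<psi> (\<kappa> n))"
    using b bound by (intro signed_\<psi>_mono) auto
  moreover have "\<sigma> \<le> \<sigma> * exp \<theta>" using sign by auto
  moreover have "\<sigma> * (exp \<theta> * \<psi> (\<kappa> n)) \<le> \<sigma> * (exp \<theta> * \<psi> (norm1 \<alpha> * (gen \<theta> - 1)))"
    by (intro signed_\<psi>_mono b bound signed_le_bound[OF nb order_refl])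
  moreover have "\<sigma> * G n = \<sigma> * (exp \<theta> * \<psi> (\<kappa> n))" by (simp only: G_eq[of n])
  moreover have "\<sigma> * (exp \<theta> * \<psi> (norm1 \<alpha> * (gen \<theta> - 1))) = \<sigma> * gen \<theta>"
    by (simp only: gen_eq[OF \<theta>_le, symmetric])
  ultimately show ?case unfolding right_diff_distrib \<psi>_0 mult_1_right by linarith
qed

lemma \<kappa>_le: "\<kappa> n \<le> norm1 \<alpha> * (xc - 1)"
  using signed_\<kappa>_bounds[OF signed_G_bounds] by (rule signed_le_bound)

text \<open>From \<open>\<kappa> n\<close> to \<open>\<kappa> (Suc n)\<close> every old summand
  moves in the direction \<sigma> by induction, and the new one,
  \<open>\<alpha> (Suc n) * (G 0 - 1)\<close>, has the sign of \<sigma> or vanishes.\<close>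

lemma signed_G_mono: "\<sigma> * G n \<le> \<sigma> * G (Suc n)"
proof (induction n rule: less_induct)
  case (less n)
  have "\<sigma> * \<kappa> n \<le> \<sigma> * \<kappa> (Suc n)"
  proof -
    have "\<sigma> * \<kappa> n = (\<Sum>s=1..n. \<alpha> s * (\<sigma> * (G (n - s) - 1)))"
      by (simp add: sum_distrib_left mult.left_commute)
    also have "\<dots> \<le> (\<Sum>s=1..n. \<alpha> s * (\<sigma> * (G (Suc n - s) - 1)))"
    proof (rule sum_mono, rule mult_left_mono)
      fix s assume s: "s \<in> {1..n}"
      then show "0 \<le> \<alpha> s" using alpha_pos[of s] by simp
      show "\<sigma> * (G (n - s) - 1) \<le> \<sigma> * (G (Suc n - s) - 1)"
        using less[of "n - s"] s by (simp add: right_diff_distrib Suc_diff_le)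
    qed
    also have "\<dots> \<le> (\<Sum>s=1..Suc n. \<alpha> s * (\<sigma> * (G (Suc n - s) - 1)))"
      using alpha_pos[of "Suc n"] signed_G_bounds[of 0] by simp
    also have "\<dots> = \<sigma> * \<kappa> (Suc n)" by (simp add: sum_distrib_left mult.left_commute del: sum.cl_ivl_Suc)
    finally show ?thesis .
  qed
  then show ?case unfolding G_eq[of n] G_eq[of "Suc n"] by (intro signed_\<psi>_mono \<kappa>_le)
qed

text \<open>A monotone bounded sequence has a limit \<open>L\<close>. Passing to the limit in the
  recursion, through the convolution and the continuity of \<phi> up to \<open>xc\<close>, gives
  \<open>L = exp \<theta> * \<phi> L\<close>. As \<open>L\<close> lies in \<open>(0, xc]\<close>,
  this means \<open>h L = \<theta>\<close>, so \<open>L\<close> is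
  \<open>gen \<theta>\<close>.\<close>

lemma signed_G_tendsto: "G \<longlonglongrightarrow> gen \<theta>"
proof -
  have "incseq (\<lambda>n. \<sigma> * G n)" by (intro incseq_SucI signed_G_mono)
  moreover have "\<forall>n. \<sigma> * G n \<le> \<sigma> * gen \<theta>" using signed_G_bounds by (simp add: right_diff_distrib)
  ultimately obtain L' where L': "(\<lambda>n. \<sigma> * G n) \<longlonglongrightarrow> L'" by (rule incseq_convergent)
  define L where "L = \<sigma> * L'"
  have "\<sigma> * \<sigma> = 1" using sign by auto
  then have GL: "G \<longlonglongrightarrow> L"
    using tendsto_mult_left[OF L', of \<sigma>] by (simp add: L_def mult.assoc[symmetric])
  then have \<kappa>_lim: "\<kappa> \<longlonglongrightarrow> norm1 \<alpha> * (L - 1)"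
    using alpha_pos alpha_summable
    by (intro convolution_tendsto[where f="\<lambda>n. G n - 1"] tendsto_intros) (simp_all add: abs_of_pos)
  have "min 1 (gen \<theta>) \<le> G n \<and> G n \<le> max 1 (gen \<theta>)" for n
    using signed_G_bounds[of n] sign by auto
  then have "min 1 (gen \<theta>) \<le> L" "L \<le> max 1 (gen \<theta>)"
    using LIMSEQ_le_const[OF GL] LIMSEQ_le_const2[OF GL] by blast+
  then have L: "0 < L" "L \<le> xc" using g_solution[OF \<theta>_le] xc_gt_1 by auto
  have "(\<lambda>n. 1 + \<kappa> n / norm1 \<alpha>) \<longlonglongrightarrow> 1 + norm1 \<alpha> * (L - 1) / norm1 \<alpha>"
    using norm1_pos by (intro tendsto_intros \<kappa>_lim) auto
  then have "(\<lambda>n. 1 + \<kappa> n / norm1 \<alpha>) \<longlonglongrightarrow> L" using norm1_pos by simp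
  then have "(\<lambda>n. \<phi> (1 + \<kappa> n / norm1 \<alpha>)) \<longlonglongrightarrow> \<phi> L"
  proof (rule continuous_on_tendsto_compose[OF continuous_on_\<phi>])
    show "L \<in> {..xc}" using L by simp
    have "1 + \<kappa> n / norm1 \<alpha> \<le> xc" for n using \<kappa>_le[of n] norm1_pos by (simp add: field_simps)
    then show "eventually (\<lambda>n. 1 + \<kappa> n / norm1 \<alpha> \<in> {..xc}) sequentially" by simp
  qed
  then have "(\<lambda>n. exp \<theta> * \<phi> (1 + \<kappa> n / norm1 \<alpha>)) \<longlonglongrightarrow> exp \<theta> * \<phi> L"
    by (intro tendsto_intros)
  moreover have "exp \<theta> * \<phi> (1 + \<kappa> n / norm1 \<alpha>) = G n" for n
    unfolding \<psi>_conv_\<phi>[symmetric] by (rule G_eq[symmetric])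
  ultimately have "G \<longlonglongrightarrow> exp \<theta> * \<phi> L" by (simp only:)
  with GL have "L = exp \<theta> * \<phi> L" by (rule LIMSEQ_unique)
  then have "h L = \<theta>"
    using L by (simp add: g_equation_iff_h[symmetric] g_equation_iff integrable_exp_mark)
  with L g_h[of L] GL show ?thesis by simp
qed

end

lemma sign_cases: obtains \<sigma> :: real where "\<sigma> = 1 \<and> 0 \<le> \<theta> \<or> \<sigma> = - 1 \<and> \<theta> \<le> 0"
  by (cases "0 \<le> \<theta>") auto

lemma nn_integral_exp_N:
  "(\<integral>\<^sup>+ \<omega>. ennreal (exp (\<theta> * real (counting_process Z t \<omega>))) \<partial>M)
    = ennreal (exp (\<nu> * (\<Sum>k<t. G k - 1)))"
proof -
  obtain \<sigma> :: real where \<sigma>: "\<sigma> = 1 \<and> 0 \<le> \<theta> \<or> \<sigma> = - 1 \<and> \<theta> \<le> 0" by (rule sign_cases)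
  show ?thesis
    using nn_integral_exp_counting_process[unfolded mark_eq, of \<theta> t] integrable_exp_mult_mark[OF \<kappa>_le[OF \<sigma>]]
    unfolding \<psi>_def[abs_def] by simp
qed

lemma G_tendsto: "G \<longlonglongrightarrow> gen \<theta>"
proof -
  obtain \<sigma> :: real where "\<sigma> = 1 \<and> 0 \<le> \<theta> \<or> \<sigma> = - 1 \<and> \<theta> \<le> 0" by (rule sign_cases)
  then show ?thesis by (rule signed_G_tendsto)
qed

end

section \<open>Cumulant limit and exposed points of the counting process\<close>

lemma counting_process_measurable:
  "(\<lambda>\<omega>. real (counting_process Z t \<omega>)) \<in> borel_measurable M"
  unfolding counting_process_def of_nat_sum
  by (intro borel_measurable_sum measurable_compose[OF Z_measurable]) auto

text \<open>The normalised logarithm of the moment generating function is \<nu> times the mean of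
  the first \<open>t\<close> values \<open>G k - 1\<close>, hence has \<nu> times their limit as its
  own.\<close>

sublocale N: scaled_log_mgf M "\<lambda>t \<omega>. real (counting_process Z t \<omega>)" "{..h xc}"
  "\<Gamma> M \<nu> (norm1 \<alpha>) m"
proof
  fix \<theta> t assume "\<theta> \<in> {..h xc}"
  then have \<theta>: "\<theta> \<le> h xc" by simp
  have int: "integrable M (\<lambda>\<omega>. exp (\<theta> * real (counting_process Z t \<omega>))) \<and>
     expectation (\<lambda>\<omega>. exp (\<theta> * real (counting_process Z t \<omega>)))
       = exp (\<nu> * (\<Sum>k<t. cluster_mgf \<psi> \<alpha> \<theta> k - 1))" for t
    using nn_integral_exp_N[OF \<theta>, of t] counting_process_measurable[of t]
    by (subst nn_integral_eq_integrable[symmetric]) auto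
  then show "integrable M (\<lambda>\<omega>. exp (\<theta> * real (counting_process Z t \<omega>)))" by blast
  have "(\<lambda>n. \<nu> * ((\<Sum>k<n. cluster_mgf \<psi> \<alpha> \<theta> k - 1) / real n)) \<longlonglongrightarrow> \<nu> * (gen \<theta> - 1)"
    by (intro tendsto_intros cesaro_mean_tendsto G_tendsto \<theta>)
  then show "(\<lambda>n. ln (expectation (\<lambda>\<omega>. exp (\<theta> * real (counting_process Z n \<omega>)))) / real n)
      \<longlonglongrightarrow> \<Gamma> M \<nu> (norm1 \<alpha>) m \<theta>"
    using int by (simp add: \<Gamma>_def)
qed (rule counting_process_measurable)

lemma rate_eq: "N.rate = rate_function M \<nu> (norm1 \<alpha>) m xc"
  by (rule ext) (simp only: N.rate_def rate_function_def h_xc[symmetric])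

lemma \<Gamma>_h: "0 < y \<Longrightarrow> y \<le> xc \<Longrightarrow> \<Gamma> M \<nu> (norm1 \<alpha>) m (h y) = \<nu> * (y - 1)"
  by (simp add: \<Gamma>_def g_h)

lemma rate_lower: "0 < y \<Longrightarrow> y \<le> xc \<Longrightarrow> ereal (h y * x - \<nu> * (y - 1)) \<le> N.rate x"
  unfolding N.rate_def using \<Gamma>_h h_mono[of y xc]
  by (intro SUP_upper2[of "h y"]) auto

text \<open>Substituting \<open>\<eta> = h z\<close>, where
  \<open>\<Gamma> (h z) = \<nu> * (z - 1)\<close>, turns the inequalities of
  \<open>ex_exposing_point\<close> into those of \<open>exposes\<close>.\<close>

lemma ex_exposes:
  assumes "0 < x"
  obtains y where "0 < y" "y \<le> xc" "N.exposes (h y) x"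
proof -
  obtain y where y: "0 < y" "y < xc"
    "\<And>\<delta>. 0 < \<delta> \<Longrightarrow> \<exists>z>y. z \<le> xc \<and> \<nu> * (z - y) < (h z - h y) * (x + \<delta>)"
    "\<And>\<delta>. 0 < \<delta> \<Longrightarrow> \<exists>z<y. 0 < z \<and> \<nu> * (z - y) < (h z - h y) * (x - \<delta>)"
    by (rule ex_exposing_point[OF assms nu_pos]) blast
  have "N.exposes (h y) x"
    unfolding N.exposes_def
  proof (intro conjI allI impI)
    show "h y \<in> {..h xc}" using y h_mono[of y xc] by simp
    fix \<delta> :: real assume \<delta>: "0 < \<delta>"
    obtain z where z: "y < z" "z \<le> xc" "\<nu> * (z - y) < (h z - h y) * (x + \<delta>)" using y(3)[OF \<delta>] by blast
    show "\<exists>\<eta>\<in>{..h xc}. h y < \<eta> \<and> \<Gamma> M \<nu> (norm1 \<alpha>) m \<eta> - \<Gamma> M \<nu> (norm1 \<alpha>) m (h y)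
        < (\<eta> - h y) * (x + \<delta>)"
      using y(1,2) z h_strict_mono[of y z] h_mono[of z xc]
      by (intro bexI[of _ "h z"]) (auto simp: \<Gamma>_h algebra_simps)
    obtain z where z: "z < y" "0 < z" "\<nu> * (z - y) < (h z - h y) * (x - \<delta>)" using y(4)[OF \<delta>] by blast
    show "\<exists>\<eta>\<in>{..h xc}. \<eta> < h y \<and> \<Gamma> M \<nu> (norm1 \<alpha>) m \<eta> - \<Gamma> M \<nu> (norm1 \<alpha>) m (h y)
        < (\<eta> - h y) * (x - \<delta>)"
      using y(1,2) z h_strict_mono[of z y] h_mono[of z xc]
      by (intro bexI[of _ "h z"]) (auto simp: \<Gamma>_h algebra_simps)
  qed
  with y show thesis by (intro that[of y]) auto
qed

text \<open>Positive points are exposed themselves. At 0 the rate is at least \<nu>, and small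
  positive points cost hardly more than \<nu>. Negative points have infinite rate, because
  \<open>h\<close> is unbounded below near 0.\<close>

lemma exposed_points_dense:
  assumes U: "open U" "x \<in> U" and c: "N.rate x < ereal c"
  shows "\<exists>\<theta>. \<exists>y\<in>U. N.exposes \<theta> y \<and> \<theta> * y - \<Gamma> M \<nu> (norm1 \<alpha>) m \<theta> \<le> c"
proof -
  have less_c: "h y * x - \<nu> * (y - 1) < c" if "0 < y" "y \<le> xc" for y
    using le_less_trans[OF rate_lower[OF that] c] by simp
  consider "0 < x" | "x = 0" | "x < 0" by linarith
  then show ?thesis
  proof cases
    case 1
    then obtain y where y: "0 < y" "y \<le> xc" "N.exposes (h y) x" by (rule ex_exposes)
    show ?thesis using less_c[OF y(1,2)] y \<Gamma>_h[OF y(1,2)] U(2)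
      by (intro exI[of _ "h y"] bexI[of _ x]) auto
  next
    case 2
    obtain c' where c': "N.rate 0 < ereal c'" "c' < c" using ereal_dense2[OF c] 2 by auto
    \<comment> \<open>Letting \<open>y\<close> tend to 0 in the lower bound
      \<open>\<nu> * (1 - y)\<close> for the rate at 0.\<close>
    have "\<nu> \<le> c'"
    proof (rule field_le_epsilon)
      fix e :: real assume "0 < e"
      define y where "y = min 1 (e / \<nu>)"
      have y: "0 < y" "y \<le> xc" "y \<le> e / \<nu>" using \<open>0 < e\<close> nu_pos xc_gt_1 by (auto simp: y_def)
      have "\<nu> * y \<le> e" using mult_left_mono[OF y(3), of \<nu>] nu_pos by simp
      have "ereal (h y * 0 - \<nu> * (y - 1)) < ereal c'"
        using rate_lower[OF y(1,2), of 0] c'(1) by (rule le_less_trans)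
      with \<open>\<nu> * y \<le> e\<close> show "\<nu> \<le> c' + e" by (simp add: algebra_simps)
    qed
    obtain e where e: "0 < e" "ball 0 e \<subseteq> U" using U 2 openE by blast
    \<comment> \<open>Small enough to lie in \<open>U\<close> and to raise the cost above \<nu> by
      at most \<open>h xc * x' \<le> c - c'\<close>.\<close>
    define x' where "x' = min (e / 2) ((c - c') / h xc)"
    have hx: "0 < h xc" using h_xc \<theta>\<^sub>c_pos by simp
    have x': "0 < x'" "x' < e" "h xc * x' \<le> c - c'"
      using e c'(2) hx by (auto simp: x'_def min_def field_simps)
    obtain y where y: "0 < y" "y \<le> xc" "N.exposes (h y) x'" using x'(1) by (rule ex_exposes)
    have "h y * x' \<le> h xc * x'" using y x' h_mono[of y xc] by (intro mult_right_mono) auto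
    moreover have "0 \<le> \<nu> * y" using y nu_pos by simp
    ultimately have "h y * x' - \<nu> * (y - 1) \<le> c"
      using x'(3) \<open>\<nu> \<le> c'\<close> by (simp add: algebra_simps)
    moreover have "x' \<in> U" using e x' by (auto simp: subset_iff dist_real_def)
    ultimately show ?thesis using y \<Gamma>_h[OF y(1,2)]
      by (intro exI[of _ "h y"] bexI[of _ x']) auto
  next
    case 3
    \<comment> \<open>The bound on \<open>h\<close> is chosen so that, after multiplication by the
      negative \<open>x\<close>, it contradicts \<open>less_c\<close>.\<close>
    obtain y where y: "0 < y" "y \<le> 1" "\<And>z. 0 < z \<Longrightarrow> z \<le> y \<Longrightarrow> h z \<le> (c + \<nu> * (xc - 1)) / x"
      by (rule h_le_near_0) blast
    have "c + \<nu> * (xc - 1) \<le> h y * x" using y(3)[of y] y(1) 3 by (simp add: neg_le_divide_eq)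
    moreover have "\<nu> * (y - 1) \<le> \<nu> * (xc - 1)" using y nu_pos xc_gt_1 by (intro mult_left_mono) auto
    ultimately show ?thesis using less_c[of y] y xc_gt_1 by simp
  qed
qed

theorem LDP_counting_process:
  "satisfies_LDP (\<lambda>t. distr M borel (\<lambda>\<omega>. real (counting_process Z t \<omega>) / real t)) real
     (rate_function M \<nu> (norm1 \<alpha>) m xc)"
  unfolding rate_eq[symmetric]
proof (rule N.satisfies_LDP_rate)
  \<comment> \<open>The tilts \<open>h xc\<close> and \<open>- 1\<close> supply the two signs
    required for tightness; the first is positive because it equals
    \<open>\<theta>\<^sub>c\<close>.\<close>
  have "0 < h xc" using h_xc \<theta>\<^sub>c_pos by simp
  then show "h xc \<in> {..h xc}" "0 < h xc" "- 1 \<in> {..h xc}" "0 \<in> {..h xc}" by auto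
  show "\<Gamma> M \<nu> (norm1 \<alpha>) m 0 = 0" by (simp add: \<Gamma>_def gen_0)
qed (use exposed_points_dense in auto)

end

theorem theorem2p1:
  fixes M :: "'a measure"
    and \<nu> x\<^sub>c :: real
    and \<alpha> :: "nat \<Rightarrow> real"
    and l :: "nat \<Rightarrow> nat \<Rightarrow> 'a \<Rightarrow> real"
    and Z :: "nat \<Rightarrow> 'a \<Rightarrow> nat"
    and X :: "nat \<Rightarrow> 'a \<Rightarrow> real"
  assumes "discrete_marked_hawkes M \<nu> \<alpha> l Z X"
    and "summable (\<lambda>t. \<alpha> (Suc t))"
    and "integrable M (l 1 1)"
    and "norm1 \<alpha> * (\<integral>\<omega>. l 1 1 \<omega> \<partial>M) < 1"
    and "1 < x\<^sub>c"
    and "critical_equation M (norm1 \<alpha>) (l 1 1) x\<^sub>c"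
  shows "0 < \<theta>\<^sub>c M (norm1 \<alpha>) (l 1 1) x\<^sub>c \<and>
    (\<forall>\<theta>\<le>\<theta>\<^sub>c M (norm1 \<alpha>) (l 1 1) x\<^sub>c.
       minimal_solution (g_equation M (norm1 \<alpha>) (l 1 1) \<theta>) (g M (norm1 \<alpha>) (l 1 1) \<theta>)) \<and>
    satisfies_LDP (\<lambda>t. distr M borel (\<lambda>\<omega>. real (counting_process Z t \<omega>) / real t)) real
      (rate_function M \<nu> (norm1 \<alpha>) (l 1 1) x\<^sub>c)"
proof -
  interpret discrete_marked_hawkes M \<nu> \<alpha> l Z X by fact
  interpret critical_hawkes M \<nu> \<alpha> l Z X "l 1 1" x\<^sub>c
    by unfold_locales (fact refl assms)+
  show ?thesis
    using \<theta>\<^sub>c_pos minimal_solution_g LDP_counting_process unfolding h_xc by blast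
qed

end
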